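(* Let $G$ be a compact group with Haar measure $\mu$ normalized so that $\mu(G)=1$, and let $\operatorname P$ and $\operatorname R$ be bounded linear operators on $L^2(G)$. Suppose that $\operatorname P$ commutes with the projection $g\mapsto \chi_S g$ for every measurable subset $S\subseteq G$, and that $\operatorname R$ commutes with left multiplication by elements of $G$, i.e. $\operatorname R\operatorname L_x=\operatorname L_x\operatorname R$ for all $x\in G$, where $[\operatorname L_x f](y)=f(x^{-1}y)$. Then $$\|\operatorname{PR}\|_2=\|\operatorname P\cdot \chi_G\|_2\,\|\operatorname R\|_2,$$ and consequently $\|\operatorname{PR}\|\le \|\operatorname P\cdot\chi_G\|_2\,\|\operatorname R\|_2$.
   Context: $\chi_S$ denotes the characteristic function of $S$, so $\chi_G$ is the constant function $1$. For a function, $\|\cdot\|_2$ is the $L^2(G,\mu)$-norm; for an operator, $\|\cdot\|_2$ denotes the Hilbert–Schmidt norm (possibly infinite), and $\|\cdot\|$ denotes the operator norm. *)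

theory Defs
  imports "HOL-Analysis.Analysis"
begin

text \<open>Groups are written additively (class group_add, which does NOT require
  commutativity): x + y is the product, - x the inverse, 0 the unit.\<close>

definition haar_prob :: "'g::{group_add,topological_space} measure \<Rightarrow> bool" where
  "haar_prob M \<longleftrightarrow>
     sets M = sets borel \<and>
     emeasure M UNIV = 1 \<and>
     (\<forall>x. \<forall>A \<in> sets borel. emeasure M ((\<lambda>y. x + y) ` A) = emeasure M A) \<and>
     (\<forall>A \<in> sets borel. emeasure M A = (INF U \<in> {U. open U \<and> A \<subseteq> U}. emeasure M U)) \<and>
     (\<forall>U. open U \<longrightarrow> emeasure M U = (SUP K \<in> {K. compact K \<and> K \<subseteq> U}. emeasure M K))"

text \<open>Square-integrable (complex-valued) functions; elements of L^2 are represented by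
  functions, equality in L^2 being equality almost everywhere.\<close>

definition L2 :: "'a measure \<Rightarrow> ('a \<Rightarrow> complex) set" where
  "L2 M = {f. f \<in> borel_measurable M \<and> integrable M (\<lambda>x. (cmod (f x))\<^sup>2)}"

definition l2norm :: "'a measure \<Rightarrow> ('a \<Rightarrow> complex) \<Rightarrow> real" where
  "l2norm M f = sqrt (\<integral>x. (cmod (f x))\<^sup>2 \<partial>M)"

definition l2inner :: "'a measure \<Rightarrow> ('a \<Rightarrow> complex) \<Rightarrow> ('a \<Rightarrow> complex) \<Rightarrow> complex" where
  "l2inner M f g = (\<integral>x. f x * cnj (g x) \<partial>M)"

definition bounded_op :: "'a measure \<Rightarrow> (('a \<Rightarrow> complex) \<Rightarrow> ('a \<Rightarrow> complex)) \<Rightarrow> bool" where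
  "bounded_op M T \<longleftrightarrow>
     (\<forall>f \<in> L2 M. T f \<in> L2 M) \<and>
     (\<forall>f \<in> L2 M. \<forall>g \<in> L2 M. (AE x in M. f x = g x) \<longrightarrow> (AE x in M. T f x = T g x)) \<and>
     (\<forall>f \<in> L2 M. \<forall>g \<in> L2 M. \<forall>a b.
        AE x in M. T (\<lambda>y. a * f y + b * g y) x = a * T f x + b * T g x) \<and>
     (\<exists>C. \<forall>f \<in> L2 M. l2norm M (T f) \<le> C * l2norm M f)"

definition op_norm :: "'a measure \<Rightarrow> (('a \<Rightarrow> complex) \<Rightarrow> ('a \<Rightarrow> complex)) \<Rightarrow> real" where
  "op_norm M T = Sup {l2norm M (T f) | f. f \<in> L2 M \<and> l2norm M f \<le> 1}"

definition onb :: "'a measure \<Rightarrow> ('a \<Rightarrow> complex) set \<Rightarrow> bool" where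
  "onb M B \<longleftrightarrow> B \<subseteq> L2 M \<and>
     (\<forall>e \<in> B. l2norm M e = 1) \<and>
     (\<forall>e \<in> B. \<forall>e' \<in> B. e \<noteq> e' \<longrightarrow> l2inner M e e' = 0) \<and>
     (\<forall>f \<in> L2 M. (\<forall>e \<in> B. l2inner M f e = 0) \<longrightarrow> l2norm M f = 0)"

definition hs_norm_sq :: "'a measure \<Rightarrow> (('a \<Rightarrow> complex) \<Rightarrow> ('a \<Rightarrow> complex)) \<Rightarrow> ennreal" where
  "hs_norm_sq M T = (\<integral>\<^sup>+ e. ennreal ((l2norm M (T e))\<^sup>2) \<partial>count_space (SOME B. onb M B))"

definition hs_norm :: "'a measure \<Rightarrow> (('a \<Rightarrow> complex) \<Rightarrow> ('a \<Rightarrow> complex)) \<Rightarrow> ennreal" where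
  "hs_norm M T = (if hs_norm_sq M T = \<infinity> then \<infinity> else ennreal (sqrt (enn2real (hs_norm_sq M T))))"

end

theory Submission
  imports Defs
begin

text \<open>Commuting with all multiplications by indicators forces \<open>P\<close> to be multiplication by
  \<open>\<phi> = P 1\<close>. For an orthonormal basis \<open>B\<close>, the set function
  \<open>\<nu> A = (\<Sum>e\<in>B. \<integral>\<^sub>A \<bar>R e\<bar>\<^sup>2)\<close> is the squared Hilbert--Schmidt norm of \<open>\<chi>\<^sub>A R\<close>. As \<open>R\<close> commutes
  with translations and these permute orthonormal bases, \<open>\<nu>\<close> is left invariant, hence
  \<open>\<nu> = \<nu> G \<cdot> \<mu>\<close>, and integrating \<open>\<bar>\<phi>\<bar>\<^sup>2\<close> against \<open>\<nu>\<close> gives the claim. Since \<open>\<nu>\<close> may be infinite, the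
  uniqueness argument is done by hand: averaging \<open>\<nu>\<^sub>F (x A) \<le> \<nu> A\<close> over \<open>x\<close> for the
  finite partial sums \<open>\<nu>\<^sub>F\<close> yields \<open>\<mu> A \<cdot> \<nu> G \<le> \<nu> A\<close>, and the same inequality for the
  complement of \<open>A\<close> gives the converse.\<close>

subsection \<open>Square-integrable functions\<close>

text \<open>The group need not be second countable, and this causes two difficulties. First,
  \<open>L2 M\<close> may be non-separable, so \<open>B\<close> may be uncountable and a pointwise
  sum over \<open>B\<close> need not commute with integration over the group; estimates are
  therefore proved for finite subsets of \<open>B\<close> and only then passed to the supremum.
  Second, for a Borel set \<open>A\<close> the indicator of \<open>A\<close> at
  \<open>- x + y\<close> may fail to be measurable for the product of the Borel sigma-algebras,
  which rules out a direct use of Tonelli; regularity and Urysohn's lemma put a continuous function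
  in its place. The inequality for a translated set comes from a one-sided comparison: finitely many
  translated basis vectors form an orthonormal family, and the Hilbert-Schmidt sum over any finite
  orthonormal family is at most the sum over a basis. The passage to the complement closes the gap
  because both set functions are additive and the total mass of the Haar measure is 1.\<close>

lemma L2_measurable [measurable_dest]: "f \<in> L2 M \<Longrightarrow> f \<in> borel_measurable M"
  by (simp add: L2_def)

lemma L2_integrable: "f \<in> L2 M \<Longrightarrow> integrable M (\<lambda>x. (cmod (f x))\<^sup>2)"
  by (simp add: L2_def)

lemma L2_I_nn_integral:
  assumes [measurable]: "f \<in> borel_measurable M"
    and fin: "(\<integral>\<^sup>+x. ennreal ((cmod (f x))\<^sup>2) \<partial>M) < \<infinity>"
  shows "f \<in> L2 M"
  unfolding L2_def using fin by (auto intro!: integrableI_bounded)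

lemma L2_zero: "(\<lambda>_. 0) \<in> L2 M"
  by (simp add: L2_def)

lemma L2_lincomb:
  assumes f: "f \<in> L2 M" and g: "g \<in> L2 M"
  shows "(\<lambda>x. a * f x + b * g x) \<in> L2 M"
proof -
  note [measurable] = L2_measurable[OF f] L2_measurable[OF g]
  have ineq: "(cmod (a * f x + b * g x))\<^sup>2
      \<le> 2 * (cmod a)\<^sup>2 * (cmod (f x))\<^sup>2 + 2 * (cmod b)\<^sup>2 * (cmod (g x))\<^sup>2" for x
  proof -
    have "(cmod (a * f x + b * g x))\<^sup>2 \<le> (cmod (a * f x) + cmod (b * g x))\<^sup>2"
      by (intro power_mono norm_triangle_ineq) auto
    also have "\<dots> \<le> 2 * (cmod (a * f x))\<^sup>2 + 2 * (cmod (b * g x))\<^sup>2"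
      using sum_squares_bound[of "cmod (a * f x)" "cmod (b * g x)"] by (simp add: power2_sum)
    finally show ?thesis by (simp add: norm_mult power_mult_distrib)
  qed
  have "integrable M (\<lambda>x. (cmod (a * f x + b * g x))\<^sup>2)"
    by (rule Bochner_Integration.integrable_bound
        [where f = "\<lambda>x. 2 * (cmod a)\<^sup>2 * (cmod (f x))\<^sup>2 + 2 * (cmod b)\<^sup>2 * (cmod (g x))\<^sup>2"])
      (use ineq in \<open>auto intro!: L2_integrable f g\<close>)
  then show ?thesis by (simp add: L2_def)
qed

lemma L2_scale: "f \<in> L2 M \<Longrightarrow> (\<lambda>x. a * f x) \<in> L2 M"
  using L2_lincomb[of f M f a 0] by simp

lemma L2_diff: "f \<in> L2 M \<Longrightarrow> g \<in> L2 M \<Longrightarrow> (\<lambda>x. f x - g x) \<in> L2 M"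
  using L2_lincomb[of f M g 1 "-1"] by simp

lemma L2_sum:
  assumes "finite I" "\<And>i. i \<in> I \<Longrightarrow> f i \<in> L2 M"
  shows "(\<lambda>x. \<Sum>i\<in>I. c i * f i x) \<in> L2 M"
  using assms
proof (induction rule: finite_induct)
  case (insert i I)
  then have "(\<lambda>x. c i * f i x + 1 * (\<Sum>i\<in>I. c i * f i x)) \<in> L2 M"
    by (intro L2_lincomb) auto
  with insert show ?case by simp
qed (simp add: L2_zero)

lemma L2_indicator_mult:
  assumes A: "A \<in> sets M" and f: "f \<in> L2 M"
  shows "(\<lambda>x. indicator A x * f x) \<in> L2 M"
proof -
  note [measurable] = A L2_measurable[OF f]
  have "integrable M (\<lambda>x. (cmod (indicator A x * f x))\<^sup>2)"
    by (rule Bochner_Integration.integrable_bound[OF L2_integrable[OF f]])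
      (auto simp: indicator_def)
  then show ?thesis by (simp add: L2_def)
qed

lemma l2norm_nonneg [simp]: "0 \<le> l2norm M f"
  by (simp add: l2norm_def)

lemma l2norm_sq: "(l2norm M f)\<^sup>2 = (\<integral>x. (cmod (f x))\<^sup>2 \<partial>M)"
  by (simp add: l2norm_def)

lemma ennreal_l2norm_sq:
  "f \<in> L2 M \<Longrightarrow> ennreal ((l2norm M f)\<^sup>2) = (\<integral>\<^sup>+x. ennreal ((cmod (f x))\<^sup>2) \<partial>M)"
  unfolding l2norm_sq by (rule nn_integral_eq_integral[symmetric]) (auto intro: L2_integrable)

lemma l2norm_cong_AE:
  "f \<in> L2 M \<Longrightarrow> g \<in> L2 M \<Longrightarrow> AE x in M. f x = g x \<Longrightarrow> l2norm M f = l2norm M g"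
  unfolding l2norm_def
  by (intro arg_cong[of _ _ sqrt] integral_cong_AE) (auto dest: L2_measurable)

lemma l2norm_eq_0_iff:
  assumes "f \<in> L2 M"
  shows "l2norm M f = 0 \<longleftrightarrow> (AE x in M. f x = 0)"
  using integral_nonneg_eq_0_iff_AE[OF L2_integrable[OF assms]] by (simp add: l2norm_def)

section \<open>Inner product, orthonormal families and Bessel's inequality\<close>

lemma L2_inner_integrable:
  assumes f: "f \<in> L2 M" and g: "g \<in> L2 M"
  shows "integrable M (\<lambda>x. f x * cnj (g x))"
proof -
  note [measurable] = L2_measurable[OF f] L2_measurable[OF g]
  have m: "cnj \<in> borel_measurable borel"
    by (intro borel_measurable_continuous_onI continuous_intros)
  have [measurable]: "(\<lambda>x. cnj (g x)) \<in> borel_measurable M"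
    by (rule measurable_compose[OF L2_measurable[OF g] m])
  have ineq: "cmod (f x) * cmod (g x) \<le> (cmod (f x))\<^sup>2 + (cmod (g x))\<^sup>2" for x
    using sum_squares_bound[of "cmod (f x)" "cmod (g x)"] mult_nonneg_nonneg[of "cmod (f x)" "cmod (g x)"]
      norm_ge_zero[of "f x"] norm_ge_zero[of "g x"] by linarith
  show ?thesis
    by (rule Bochner_Integration.integrable_bound[where f = "\<lambda>x. (cmod (f x))\<^sup>2 + (cmod (g x))\<^sup>2"])
      (auto intro!: L2_integrable f g simp: norm_mult ineq)
qed

lemma l2inner_self: "l2inner M f f = complex_of_real ((l2norm M f)\<^sup>2)"
  unfolding l2inner_def l2norm_sq integral_complex_of_real[symmetric] complex_norm_square ..

lemma l2inner_commute: "l2inner M g f = cnj (l2inner M f g)"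
  unfolding l2inner_def by (simp add: mult.commute flip: Bochner_Integration.integral_cnj)

lemma l2inner_lincomb_left:
  assumes "f \<in> L2 M" "g \<in> L2 M" "h \<in> L2 M"
  shows "l2inner M (\<lambda>x. a * f x + b * g x) h = a * l2inner M f h + b * l2inner M g h"
proof -
  have "l2inner M (\<lambda>x. a * f x + b * g x) h = (\<integral>x. a * (f x * cnj (h x)) + b * (g x * cnj (h x)) \<partial>M)"
    unfolding l2inner_def by (intro Bochner_Integration.integral_cong) (auto simp: algebra_simps)
  also have "\<dots> = a * l2inner M f h + b * l2inner M g h"
    unfolding l2inner_def using assms
    by (subst Bochner_Integration.integral_add) (auto intro!: L2_inner_integrable)
  finally show ?thesis .
qed

lemma l2inner_diff_left:
  "f \<in> L2 M \<Longrightarrow> g \<in> L2 M \<Longrightarrow> h \<in> L2 M \<Longrightarrow>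
    l2inner M (\<lambda>x. f x - g x) h = l2inner M f h - l2inner M g h"
  using l2inner_lincomb_left[of f M g h 1 "-1"] by simp

lemma l2inner_sum_left:
  assumes "finite I" "\<And>i. i \<in> I \<Longrightarrow> f i \<in> L2 M" "h \<in> L2 M"
  shows "l2inner M (\<lambda>x. \<Sum>i\<in>I. c i * f i x) h = (\<Sum>i\<in>I. c i * l2inner M (f i) h)"
  using assms
proof (induction rule: finite_induct)
  case (insert i I)
  then have "l2inner M (\<lambda>x. c i * f i x + 1 * (\<Sum>i\<in>I. c i * f i x)) h
     = c i * l2inner M (f i) h + 1 * l2inner M (\<lambda>x. \<Sum>i\<in>I. c i * f i x) h"
    by (intro l2inner_lincomb_left L2_sum) auto
  with insert show ?case by simp
qed (simp add: l2inner_def)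

lemma l2inner_cong_AE:
  assumes f: "f \<in> L2 M" and f': "f' \<in> L2 M" and g: "g \<in> L2 M" and "AE x in M. f x = f' x"
  shows "l2inner M f g = l2inner M f' g"
  unfolding l2inner_def
  by (rule integral_cong_AE)
    (use assms in \<open>auto intro!: borel_measurable_integrable L2_inner_integrable\<close>)

lemma l2norm_diff_sq:
  assumes f: "f \<in> L2 M" and g: "g \<in> L2 M"
  shows "(l2norm M (\<lambda>x. f x - g x))\<^sup>2 = (l2norm M f)\<^sup>2 - 2 * Re (l2inner M f g) + (l2norm M g)\<^sup>2"
proof -
  have d: "(\<lambda>x. f x - g x) \<in> L2 M" by (rule L2_diff[OF f g])
  have "l2inner M (\<lambda>x. f x - g x) (\<lambda>x. f x - g x)
      = cnj (l2inner M (\<lambda>x. f x - g x) f) - cnj (l2inner M (\<lambda>x. f x - g x) g)"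
    using l2inner_diff_left[OF f g d] l2inner_commute[of M f "\<lambda>x. f x - g x"]
      l2inner_commute[of M g "\<lambda>x. f x - g x"] by simp
  also have "\<dots> = cnj (l2inner M f f) - cnj (l2inner M g f) - cnj (l2inner M f g) + cnj (l2inner M g g)"
    by (simp add: l2inner_diff_left f g)
  finally have "Re (l2inner M (\<lambda>x. f x - g x) (\<lambda>x. f x - g x))
    = Re (cnj (l2inner M f f) - cnj (l2inner M g f) - cnj (l2inner M f g) + cnj (l2inner M g g))"
    by simp
  then show ?thesis
    using l2inner_commute[of M f g] by (simp add: l2inner_self)
qed

text \<open>Indexed families rather than sets of functions: the translate of a family keeps its
  index set, so sums over it need no injectivity argument, and a single normalized vector is a
  family over \<open>{()}\<close>.\<close>

definition orthonormal_family :: "'a measure \<Rightarrow> 'i set \<Rightarrow> ('i \<Rightarrow> 'a \<Rightarrow> complex) \<Rightarrow> bool" where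
  "orthonormal_family M I f \<longleftrightarrow> (\<forall>i\<in>I. f i \<in> L2 M) \<and>
     (\<forall>i\<in>I. \<forall>j\<in>I. l2inner M (f i) (f j) = (if i = j then 1 else 0))"

lemma orthonormal_family_subset:
  "orthonormal_family M I f \<Longrightarrow> J \<subseteq> I \<Longrightarrow> orthonormal_family M J f"
  unfolding orthonormal_family_def by blast

lemma orthonormal_family_L2: "orthonormal_family M I f \<Longrightarrow> i \<in> I \<Longrightarrow> f i \<in> L2 M"
  unfolding orthonormal_family_def by blast

lemma onb_L2: "onb M B \<Longrightarrow> e \<in> B \<Longrightarrow> e \<in> L2 M"
  unfolding onb_def by blast

lemma onb_orthonormal: "onb M B \<Longrightarrow> orthonormal_family M B (\<lambda>e. e)"
  unfolding onb_def orthonormal_family_def by (auto simp: l2inner_self)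

lemma l2inner_orthonormal_sum:
  assumes o: "orthonormal_family M I f" and J: "finite J" "J \<subseteq> I" and i: "i \<in> I"
  shows "l2inner M (\<lambda>x. \<Sum>j\<in>J. c j * f j x) (f i) = (if i \<in> J then c i else 0)"
proof -
  have "l2inner M (\<lambda>x. \<Sum>j\<in>J. c j * f j x) (f i) = (\<Sum>j\<in>J. c j * l2inner M (f j) (f i))"
    using J i o by (intro l2inner_sum_left) (auto simp: orthonormal_family_def)
  also have "\<dots> = (\<Sum>j\<in>J. if i = j then c j else 0)"
    using J i o by (intro sum.cong) (auto simp: orthonormal_family_def)
  finally show ?thesis using J by simp
qed

lemma l2norm_orthonormal_sum:
  assumes o: "orthonormal_family M I f" and J: "finite I"
  shows "(l2norm M (\<lambda>x. \<Sum>i\<in>I. c i * f i x))\<^sup>2 = (\<Sum>i\<in>I. (cmod (c i))\<^sup>2)"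
proof -
  let ?v = "\<lambda>x. \<Sum>i\<in>I. c i * f i x"
  have v: "?v \<in> L2 M" by (rule L2_sum[OF J orthonormal_family_L2[OF o]])
  have "l2inner M ?v ?v = (\<Sum>i\<in>I. c i * l2inner M (f i) ?v)"
    by (rule l2inner_sum_left[OF J orthonormal_family_L2[OF o] v])
  also have "\<dots> = (\<Sum>i\<in>I. complex_of_real ((cmod (c i))\<^sup>2))"
  proof (intro sum.cong refl)
    fix i assume "i \<in> I"
    then have "l2inner M (f i) ?v = cnj (c i)"
      using l2inner_orthonormal_sum[OF o J order_refl, of i c] l2inner_commute[of M "f i" ?v] by simp
    then show "c i * l2inner M (f i) ?v = complex_of_real ((cmod (c i))\<^sup>2)"
      by (simp only: complex_norm_square)
  qed
  finally have "complex_of_real ((l2norm M ?v)\<^sup>2) = complex_of_real (\<Sum>i\<in>I. (cmod (c i))\<^sup>2)"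
    by (simp add: l2inner_self)
  then show ?thesis using of_real_eq_iff by blast
qed

text \<open>The exact identity serves twice: nonnegativity of its left side is Bessel's inequality,
  and smallness of its left side gives the lower half of Parseval's identity.\<close>

lemma l2norm_projection_residual:
  assumes o: "orthonormal_family M I f" and J: "finite I" and v: "v \<in> L2 M"
  shows "(l2norm M (\<lambda>x. v x - (\<Sum>i\<in>I. l2inner M v (f i) * f i x)))\<^sup>2
    = (l2norm M v)\<^sup>2 - (\<Sum>i\<in>I. (cmod (l2inner M v (f i)))\<^sup>2)"
proof -
  let ?p = "\<lambda>x. \<Sum>i\<in>I. l2inner M v (f i) * f i x"
  have p: "?p \<in> L2 M" by (rule L2_sum[OF J orthonormal_family_L2[OF o]])
  have "l2inner M ?p v = (\<Sum>i\<in>I. l2inner M v (f i) * l2inner M (f i) v)"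
    by (rule l2inner_sum_left[OF J orthonormal_family_L2[OF o] v])
  also have "\<dots> = (\<Sum>i\<in>I. complex_of_real ((cmod (l2inner M v (f i)))\<^sup>2))"
    using l2inner_commute[of M _ v]
    by (intro sum.cong refl) (simp add: complex_norm_square del: of_real_power)
  finally have "Re (l2inner M v ?p) = (\<Sum>i\<in>I. (cmod (l2inner M v (f i)))\<^sup>2)"
    using l2inner_commute[of M v ?p] by (simp add: Re_sum)
  then show ?thesis
    by (simp add: l2norm_diff_sq[OF v p] l2norm_orthonormal_sum[OF o J])
qed

lemma bessel:
  assumes "orthonormal_family M I f" "finite I" "v \<in> L2 M"
  shows "(\<Sum>i\<in>I. (cmod (l2inner M v (f i)))\<^sup>2) \<le> (l2norm M v)\<^sup>2"
  using zero_le_power2[of "l2norm M (\<lambda>x. v x - (\<Sum>i\<in>I. l2inner M v (f i) * f i x))"]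
  unfolding l2norm_projection_residual[OF assms] by simp

lemma l2norm_scale: "l2norm M (\<lambda>x. a * f x) = cmod a * l2norm M f"
  unfolding l2norm_def by (simp add: norm_mult power_mult_distrib real_sqrt_mult)

lemma normalize_orthonormal:
  assumes "f \<in> L2 M" "l2norm M f \<noteq> 0"
  shows "orthonormal_family M {()} (\<lambda>_ x. complex_of_real (1 / l2norm M f) * f x)"
proof -
  have "l2norm M (\<lambda>x. complex_of_real (1 / l2norm M f) * f x) = 1"
    unfolding l2norm_scale norm_of_real using assms by simp
  then show ?thesis
    unfolding orthonormal_family_def using assms(1)
    by (simp add: l2inner_self L2_scale del: of_real_divide)
qed

text \<open>Bessel's inequality for the one-element family consisting of \<open>g\<close> divided by
  its norm; a \<open>g\<close> of norm zero vanishes almost everywhere and is treated apart.\<close>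

lemma l2inner_Cauchy_Schwarz:
  assumes f: "f \<in> L2 M" and g: "g \<in> L2 M"
  shows "cmod (l2inner M f g) \<le> l2norm M f * l2norm M g"
proof (cases "l2norm M g = 0")
  case True
  then have "AE x in M. g x = 0" using l2norm_eq_0_iff[OF g] by simp
  then have "l2inner M g f = l2inner M (\<lambda>_. 0) f"
    by (intro l2inner_cong_AE f g L2_zero) auto
  then have "l2inner M g f = 0" by (simp add: l2inner_def)
  then show ?thesis using True l2inner_commute[of M f g] by simp
next
  case False
  let ?c = "complex_of_real (1 / l2norm M g)"
  have "(cmod (l2inner M f (\<lambda>x. ?c * g x)))\<^sup>2 \<le> (l2norm M f)\<^sup>2"
    using bessel[OF normalize_orthonormal[OF g False] _ f] by simp
  then have "cmod (l2inner M f (\<lambda>x. ?c * g x)) \<le> l2norm M f"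
    by (rule power2_le_imp_le) simp
  moreover have "l2inner M f (\<lambda>x. ?c * g x) = ?c * l2inner M f g"
    using l2inner_lincomb_left[OF g g f, of ?c 0] l2inner_commute[of M f g]
      l2inner_commute[of M f "\<lambda>x. ?c * g x"] by simp
  ultimately have "cmod (l2inner M f g) / l2norm M g \<le> l2norm M f"
    unfolding norm_mult norm_of_real by (simp add: norm_mult norm_divide)
  then show ?thesis
    using False l2norm_nonneg[of M g] by (simp add: pos_divide_le_eq less_le)
qed

subsection \<open>Completeness and orthonormal bases\<close>

text \<open>Fatou's lemma for the squared moduli. Membership of \<open>g\<close> in
  \<open>L2 M\<close> is part of the conclusion, which matters when the limit contains a product not
  known in advance to be square-integrable.\<close>

lemma L2_Fatou:
  assumes s: "\<And>k. s k \<in> L2 M" and g [measurable]: "g \<in> borel_measurable M"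
    and lim: "AE x in M. (\<lambda>k. s k x) \<longlonglongrightarrow> g x"
    and le: "eventually (\<lambda>k. (l2norm M (s k))\<^sup>2 \<le> c) sequentially"
  shows "g \<in> L2 M" and "(l2norm M g)\<^sup>2 \<le> c"
proof -
  note [measurable] = L2_measurable[OF s]
  have "0 \<le> c"
    using eventually_happens'[OF _ le] by (auto intro: order_trans[OF zero_le_power2])
  have "(\<integral>\<^sup>+x. ennreal ((cmod (g x))\<^sup>2) \<partial>M) = (\<integral>\<^sup>+x. liminf (\<lambda>k. ennreal ((cmod (s k x))\<^sup>2)) \<partial>M)"
  proof (rule nn_integral_cong_AE, use lim in eventually_elim)
    case (elim x)
    then have "(\<lambda>k. ennreal ((cmod (s k x))\<^sup>2)) \<longlonglongrightarrow> ennreal ((cmod (g x))\<^sup>2)"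
      by (intro tendsto_intros)
    from lim_imp_Liminf[OF sequentially_bot this] show ?case by (rule sym)
  qed
  also have "\<dots> \<le> liminf (\<lambda>k. \<integral>\<^sup>+x. ennreal ((cmod (s k x))\<^sup>2) \<partial>M)"
    by (rule nn_integral_liminf) simp
  also have "\<dots> = liminf (\<lambda>k. ennreal ((l2norm M (s k))\<^sup>2))"
    by (simp add: ennreal_l2norm_sq s)
  also have "\<dots> \<le> limsup (\<lambda>k. ennreal ((l2norm M (s k))\<^sup>2))"
    by (rule Liminf_le_Limsup) simp
  also have "\<dots> \<le> ennreal c"
    by (rule Limsup_bounded) (use le in eventually_elim, rule ennreal_leI)
  finally have *: "(\<integral>\<^sup>+x. ennreal ((cmod (g x))\<^sup>2) \<partial>M) \<le> ennreal c" .
  then show gL: "g \<in> L2 M"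
    by (intro L2_I_nn_integral g) (auto simp: less_top[symmetric] top_unique)
  show "(l2norm M g)\<^sup>2 \<le> c"
    using * \<open>0 \<le> c\<close> by (simp add: ennreal_l2norm_sq[OF gL, symmetric])
qed

text \<open>The Riesz-Fischer argument for a prescribed Cauchy rate: summable increments give almost
  everywhere convergence, and Fatou's lemma transfers the rate to the limit.\<close>

lemma L2_complete_geometric:
  assumes s: "\<And>n. s n \<in> L2 M"
    and le: "\<And>n k. n \<le> k \<Longrightarrow> (l2norm M (\<lambda>x. s k x - s n x))\<^sup>2 \<le> (1/8)^n"
  obtains g where "g \<in> L2 M" "\<And>n. (l2norm M (\<lambda>x. s n x - g x))\<^sup>2 \<le> (1/8)^n"
proof -
  note [measurable] = L2_measurable[OF s]
  \<comment> \<open>The weight \<open>4^n\<close> against the rate \<open>(1/8)^n\<close> leaves the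
    summable \<open>(1/2)^n\<close>. Wherever the weighted sum is finite, the increments are bounded
    by a multiple of \<open>(1/2)^n\<close>, so the sequence converges there.\<close>
  let ?D = "\<lambda>n x. ennreal (4^n) * ennreal ((cmod (s (Suc n) x - s n x))\<^sup>2)"
  have "(\<integral>\<^sup>+x. (\<Sum>n. ?D n x) \<partial>M) = (\<Sum>n. \<integral>\<^sup>+x. ?D n x \<partial>M)"
    by (rule nn_integral_suminf) simp
  also have "\<dots> \<le> (\<Sum>n. ennreal ((1/2)^n))"
  proof (rule suminf_le)
    fix n
    have "(\<integral>\<^sup>+x. ?D n x \<partial>M) = ennreal (4^n) * ennreal ((l2norm M (\<lambda>x. s (Suc n) x - s n x))\<^sup>2)"
      by (subst nn_integral_cmult) (simp_all add: ennreal_l2norm_sq L2_diff s)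
    also have "\<dots> \<le> ennreal (4^n) * ennreal ((1/8)^n)"
      by (intro mult_left_mono ennreal_leI le) auto
    also have "\<dots> = ennreal ((1/2)^n)"
      by (simp add: ennreal_mult[symmetric] power_mult_distrib[symmetric])
    finally show "(\<integral>\<^sup>+x. ?D n x \<partial>M) \<le> ennreal ((1/2)^n)" .
  qed auto
  also have "\<dots> = ennreal (\<Sum>n. (1/2)^n)"
    by (rule suminf_ennreal2) (auto intro: summable_geometric)
  finally have "(\<integral>\<^sup>+x. (\<Sum>n. ?D n x) \<partial>M) \<noteq> \<infinity>"
    by (auto simp: top_unique)
  then have "AE x in M. (\<Sum>n. ?D n x) \<noteq> \<infinity>"
    by (intro nn_integral_PInf_AE) auto
  then have conv: "AE x in M. convergent (\<lambda>n. s n x)"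
  proof eventually_elim
    case (elim x)
    define S where "S = enn2real (\<Sum>n. ?D n x)"
    have S: "0 \<le> S" "(\<Sum>n. ?D n x) = ennreal S"
      using elim by (auto simp: S_def less_top)
    have "cmod (s (Suc n) x - s n x) \<le> sqrt S * (1/2)^n" for n
    proof -
      have "?D n x \<le> ennreal S"
        using sum_le_suminf[of "\<lambda>n. ?D n x" "{n}"] by (simp add: S)
      then have "4^n * (cmod (s (Suc n) x - s n x))\<^sup>2 \<le> S"
        using S by (simp add: ennreal_mult[symmetric])
      then have "(cmod (s (Suc n) x - s n x))\<^sup>2 \<le> (1/4)^n * S"
        by (simp add: field_simps power_divide)
      also have "\<dots> = (sqrt S * (1/2)^n)\<^sup>2"
        using S by (simp add: power_mult_distrib power_divide power_mult[symmetric] mult.commute[of n 2] power_mult)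
      finally show ?thesis
        by (rule power2_le_imp_le) (use S in simp)
    qed
    moreover have "summable (\<lambda>n. sqrt S * (1/2)^n)"
      by (rule summable_mult, rule summable_geometric) simp
    ultimately have "summable (\<lambda>n. s (Suc n) x - s n x)"
      by (rule summable_comparison_test'[where N = 0, rotated])
    then have "convergent (\<lambda>n. s n x - s 0 x)"
      unfolding summable_iff_convergent sum_lessThan_telescope[where f = "\<lambda>n. s n x"] .
    from convergent_add[OF this convergent_const[of "s 0 x"]] show ?case by simp
  qed
  define g where "g = (\<lambda>x. lim (\<lambda>n. s n x))"
  have g [measurable]: "g \<in> borel_measurable M"
    unfolding g_def by (rule borel_measurable_lim_metric) simp
  have lim: "AE x in M. (\<lambda>k. s n x - s k x) \<longlonglongrightarrow> s n x - g x" for n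
    using conv unfolding g_def by eventually_elim (auto intro!: tendsto_intros simp: convergent_LIMSEQ_iff)
  have ev: "eventually (\<lambda>k. (l2norm M (\<lambda>x. s n x - s k x))\<^sup>2 \<le> (1/8)^n) sequentially" for n
  proof (rule eventually_sequentiallyI)
    fix k assume "n \<le> k"
    then show "(l2norm M (\<lambda>x. s n x - s k x))\<^sup>2 \<le> (1/8)^n"
      using le[of n k] by (simp add: l2norm_def norm_minus_commute)
  qed
  have d: "(\<lambda>x. s n x - g x) \<in> L2 M" "(l2norm M (\<lambda>x. s n x - g x))\<^sup>2 \<le> (1/8)^n" for n
    using L2_Fatou[OF L2_diff[OF s s] _ lim ev, of n] by auto
  have "g \<in> L2 M"
    using L2_diff[OF s d(1), of 0 0] by simp
  with d show ?thesis by (intro that)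
qed

text \<open>Completeness enters \<open>onb\<close> only as the absence of nonzero vectors orthogonal
  to \<open>B\<close>; density of finite combinations is derived from it here. Finite sets whose
  Bessel sums approach the supremum yield a geometrically Cauchy sequence of projections, and
  \<open>v\<close> minus its limit is orthogonal to \<open>B\<close>.\<close>

lemma onb_approx:
  assumes B: "onb M B" and v: "v \<in> L2 M" and eps: "0 < \<epsilon>"
  obtains F where "finite F" "F \<subseteq> B"
    "(l2norm M (\<lambda>x. v x - (\<Sum>e\<in>F. l2inner M v e * e x)))\<^sup>2 < \<epsilon>"
proof -
  note o = onb_orthonormal[OF B]
  define q where "q F = (\<Sum>e\<in>F. (cmod (l2inner M v e))\<^sup>2)" for F
  define S where "S = (SUP F\<in>{F. finite F \<and> F \<subseteq> B}. q F)"
  have bdd: "bdd_above (q ` {F. finite F \<and> F \<subseteq> B})"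
    using bessel[OF orthonormal_family_subset[OF o] _ v] by (auto simp: q_def bdd_above_def)
  have qS: "q F \<le> S" if "finite F" "F \<subseteq> B" for F
    unfolding S_def using that bdd by (intro cSUP_upper) auto
  have "\<exists>G. finite G \<and> G \<subseteq> B \<and> S - (1/8)^n < q G" for n :: nat
  proof -
    have "\<exists>G\<in>{F. finite F \<and> F \<subseteq> B}. S - (1/8)^n < q G"
      by (subst less_cSUP_iff[symmetric]) (use bdd in \<open>auto simp: S_def\<close>)
    then show ?thesis by auto
  qed
  then obtain G where G: "\<And>n. finite (G n)" "\<And>n. G n \<subseteq> B" "\<And>n. S - (1/8)^n < q (G n)"
    by metis
  \<comment> \<open>Unions make the sets nested, so that differences of partial sums are again sums
    over basis vectors with known norm; enlarging a set only raises \<open>q\<close>.\<close>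
  define F where "F n = (\<Union>i\<le>n. G i)" for n
  have F: "finite (F n)" "F n \<subseteq> B" for n using G by (auto simp: F_def)
  have Fmono: "F n \<subseteq> F k" if "n \<le> k" for n k using that by (force simp: F_def)
  have qF: "S - (1/8)^n < q (F n)" for n
  proof -
    have "q (G n) \<le> q (F n)"
      unfolding q_def by (intro sum_mono2) (auto simp: F_def G)
    with G(3)[of n] show ?thesis by linarith
  qed
  define s where "s n = (\<lambda>x. \<Sum>e\<in>F n. l2inner M v e * e x)" for n
  have sL: "s n \<in> L2 M" for n
    unfolding s_def using F by (intro L2_sum) (auto intro: onb_L2[OF B])
  have "(l2norm M (\<lambda>x. s k x - s n x))\<^sup>2 \<le> (1/8)^n" if "n \<le> k" for n k
  proof -
    have "(l2norm M (\<lambda>x. s k x - s n x))\<^sup>2 = (l2norm M (\<lambda>x. \<Sum>e\<in>F k - F n. l2inner M v e * e x))\<^sup>2"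
      unfolding s_def by (simp add: sum_diff[OF F(1) Fmono[OF that]])
    also have "\<dots> = q (F k - F n)"
      unfolding q_def using F
      by (intro l2norm_orthonormal_sum[OF orthonormal_family_subset[OF o]]) auto
    also have "\<dots> = q (F k) - q (F n)"
      unfolding q_def by (rule sum_diff[OF F(1) Fmono[OF that]])
    finally show ?thesis using qS[OF F, of k] qF[of n] by linarith
  qed
  from L2_complete_geometric[of s, OF sL this] obtain g
    where g: "g \<in> L2 M" "\<And>n. (l2norm M (\<lambda>x. s n x - g x))\<^sup>2 \<le> (1/8)^n" by blast
  have "l2inner M (\<lambda>x. v x - g x) e = 0" if e: "e \<in> B" for e
  proof -
    note eL = onb_L2[OF B e]
    have bound: "(cmod (l2inner M (\<lambda>x. v x - g x) e))\<^sup>2 \<le> 4 * (1/8)^n" for n :: nat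
    proof -
      define a where "a = l2inner M v e - l2inner M (s n) e"
      define b where "b = l2inner M (s n) e - l2inner M g e"
      have "l2inner M (s n) e = (if e \<in> F n then l2inner M v e else 0)"
        unfolding s_def by (rule l2inner_orthonormal_sum[OF o F e])
      \<comment> \<open>A basis vector outside \<open>F n\<close> has a small coefficient: otherwise
        adjoining it would push the Bessel sum above the supremum \<open>S\<close>.\<close>
      moreover have "(cmod (l2inner M v e))\<^sup>2 \<le> (1/8)^n" if "e \<notin> F n"
      proof -
        have "q (insert e (F n)) = (cmod (l2inner M v e))\<^sup>2 + q (F n)"
          using that F by (simp add: q_def)
        then show ?thesis using qS[of "insert e (F n)"] F e qF[of n] by simp
      qed
      ultimately have a: "(cmod a)\<^sup>2 \<le> (1/8)^n" by (auto simp: a_def)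
      have "b = l2inner M (\<lambda>x. s n x - g x) e"
        by (simp add: b_def l2inner_diff_left sL g eL)
      then have "cmod b \<le> l2norm M (\<lambda>x. s n x - g x)"
        using l2inner_Cauchy_Schwarz[OF L2_diff[OF sL g(1)] eL] B e by (simp add: onb_def)
      then have b: "(cmod b)\<^sup>2 \<le> (1/8)^n"
        using order_trans[OF power_mono[OF _ norm_ge_zero] g(2)] by blast
      have "l2inner M (\<lambda>x. v x - g x) e = a + b"
        by (simp add: a_def b_def l2inner_diff_left v g eL)
      then have "(cmod (l2inner M (\<lambda>x. v x - g x) e))\<^sup>2 \<le> (cmod a + cmod b)\<^sup>2"
        by (simp add: norm_triangle_ineq power_mono)
      also have "\<dots> \<le> 2 * (cmod a)\<^sup>2 + 2 * (cmod b)\<^sup>2"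
        using sum_squares_bound[of "cmod a" "cmod b"] by (simp add: power2_sum)
      finally show ?thesis using a b by simp
    qed
    have "(\<lambda>n. 4 * (1/8)^n :: real) \<longlonglongrightarrow> 4 * 0"
      by (intro tendsto_intros LIMSEQ_power_zero) simp
    then have "(cmod (l2inner M (\<lambda>x. v x - g x) e))\<^sup>2 \<le> 4 * 0"
      by (rule LIMSEQ_le_const) (use bound in blast)
    then show ?thesis by simp
  qed
  then have "l2norm M (\<lambda>x. v x - g x) = 0"
    using B L2_diff[OF v g(1)] by (simp add: onb_def)
  then have ae: "AE x in M. v x - g x = 0"
    using l2norm_eq_0_iff[OF L2_diff[OF v g(1)]] by simp
  obtain n :: nat where n: "(1/8)^n < \<epsilon>"
    using real_arch_pow_inv[OF eps, of "1/8"] by auto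
  have "l2norm M (\<lambda>x. v x - s n x) = l2norm M (\<lambda>x. - 1 * (s n x - g x))"
    by (rule l2norm_cong_AE[OF L2_diff[OF v sL] L2_scale[OF L2_diff[OF sL g(1)]]])
      (use ae in eventually_elim, simp)
  also have "\<dots> = l2norm M (\<lambda>x. s n x - g x)" by (subst l2norm_scale) simp
  finally have "(l2norm M (\<lambda>x. v x - s n x))\<^sup>2 < \<epsilon>"
    using g(2)[of n] n by simp
  then show ?thesis using F[of n] that[of "F n"] by (simp add: s_def)
qed

section \<open>Sums over uncountable index sets and Parseval's identity\<close>

lemma sum_le_nn_integral_count_space:
  assumes "finite F" "F \<subseteq> A"
  shows "(\<Sum>x\<in>F. f x) \<le> (\<integral>\<^sup>+x. f x \<partial>count_space A)"
proof -
  have "(\<Sum>x\<in>F. f x) = (\<integral>\<^sup>+x. f x * indicator F x \<partial>count_space A)"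
    using assms by (subst nn_integral_count_space'[of F]) auto
  also have "\<dots> \<le> (\<integral>\<^sup>+x. f x \<partial>count_space A)"
    by (intro nn_integral_mono) (auto simp: indicator_def)
  finally show ?thesis .
qed

text \<open>Stands in for monotone convergence along the finite subsets of an uncountable set. A
  simple function below \<open>f\<close> either takes some nonzero value infinitely often, which
  forces \<open>c = top\<close>, or has finite support and is controlled by a finite sum.\<close>

lemma nn_integral_count_space_le:
  assumes le: "\<And>F. finite F \<Longrightarrow> F \<subseteq> A \<Longrightarrow> (\<Sum>x\<in>F. f x) \<le> c"
  shows "(\<integral>\<^sup>+x. f x \<partial>count_space A) \<le> c"
  unfolding nn_integral_def
proof (rule SUP_least, clarify)
  fix g assume g: "simple_function (count_space A) g" "g \<le> f"
  have fin: "finite (g ` A)" using simple_functionD(1)[OF g(1)] by simp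
  show "integral\<^sup>S (count_space A) g \<le> c"
  proof (cases "\<exists>y. y \<noteq> 0 \<and> infinite (g -` {y} \<inter> A)")
    case True
    then obtain y where y: "y \<noteq> 0" "infinite (g -` {y} \<inter> A)" by blast
    have *: "of_nat n * y \<le> c" for n
    proof -
      obtain F where F: "F \<subseteq> g -` {y} \<inter> A" "finite F" "card F = n"
        using infinite_arbitrarily_large[OF y(2)] by blast
      then have "of_nat n * y = (\<Sum>x\<in>F. g x)" by (subst sum.cong[of F F g "\<lambda>_. y"]) auto
      also have "\<dots> \<le> (\<Sum>x\<in>F. f x)" using g(2) by (intro sum_mono) (auto simp: le_fun_def)
      also have "\<dots> \<le> c" using F by (intro le) auto
      finally show ?thesis .
    qed
    have "(SUP n. of_nat n * y) = (top :: ennreal)"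
      using y(1) by (simp add: SUP_mult_right_ennreal[symmetric] ennreal_SUP_of_nat_eq_top ennreal_top_mult)
    moreover have "(SUP n. of_nat n * y) \<le> c" using * by (intro SUP_least)
    ultimately have "c = top" by (simp only: top_unique)
    then show ?thesis by simp
  next
    case False
    define F where "F = (\<Union>y\<in>g ` A - {0}. g -` {y} \<inter> A)"
    have F: "finite F" "F \<subseteq> A"
      unfolding F_def using fin False by (intro finite_UN_I finite_Diff) auto
    have "integral\<^sup>S (count_space A) g = (\<integral>\<^sup>+x. g x \<partial>count_space A)"
      by (rule nn_integral_eq_simple_integral[OF g(1), symmetric])
    also have "\<dots> = (\<Sum>x\<in>F. g x)"
      by (rule nn_integral_count_space'[OF F(1) _ F(2)]) (auto simp: F_def)
    also have "\<dots> \<le> (\<Sum>x\<in>F. f x)" using g(2) by (intro sum_mono) (auto simp: le_fun_def)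
    also have "\<dots> \<le> c" by (rule le[OF F])
    finally show ?thesis .
  qed
qed

lemma parseval:
  assumes B: "onb M B" and v: "v \<in> L2 M"
  shows "(\<integral>\<^sup>+e. ennreal ((cmod (l2inner M v e))\<^sup>2) \<partial>count_space B) = ennreal ((l2norm M v)\<^sup>2)"
proof (rule antisym)
  note o = onb_orthonormal[OF B]
  show "(\<integral>\<^sup>+e. ennreal ((cmod (l2inner M v e))\<^sup>2) \<partial>count_space B) \<le> ennreal ((l2norm M v)\<^sup>2)"
    by (rule nn_integral_count_space_le)
      (auto intro!: ennreal_leI bessel[OF orthonormal_family_subset[OF o] _ v] simp: sum_ennreal)
  show "ennreal ((l2norm M v)\<^sup>2) \<le> (\<integral>\<^sup>+e. ennreal ((cmod (l2inner M v e))\<^sup>2) \<partial>count_space B)"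
  proof (rule ennreal_le_epsilon)
    fix \<epsilon> :: real assume "0 < \<epsilon>"
    from onb_approx[OF B v this] obtain F where F: "finite F" "F \<subseteq> B"
      "(l2norm M (\<lambda>x. v x - (\<Sum>e\<in>F. l2inner M v e * e x)))\<^sup>2 < \<epsilon>" by blast
    then have "(l2norm M v)\<^sup>2 \<le> (\<Sum>e\<in>F. (cmod (l2inner M v e))\<^sup>2) + \<epsilon>"
      using l2norm_projection_residual[OF orthonormal_family_subset[OF o F(2)] F(1) v] by simp
    then have "ennreal ((l2norm M v)\<^sup>2) \<le> (\<Sum>e\<in>F. ennreal ((cmod (l2inner M v e))\<^sup>2)) + ennreal \<epsilon>"
      using \<open>0 < \<epsilon>\<close> by (simp add: sum_ennreal sum_nonneg flip: ennreal_plus)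
    also have "\<dots> \<le> (\<integral>\<^sup>+e. ennreal ((cmod (l2inner M v e))\<^sup>2) \<partial>count_space B) + ennreal \<epsilon>"
      by (intro add_mono sum_le_nn_integral_count_space F order_refl)
    finally show "ennreal ((l2norm M v)\<^sup>2)
      \<le> (\<integral>\<^sup>+e. ennreal ((cmod (l2inner M v e))\<^sup>2) \<partial>count_space B) + ennreal \<epsilon>" .
  qed
qed

text \<open>Guarantees that \<open>SOME\<close> in \<open>hs_norm_sq\<close> picks an actual basis.
  Zorn's lemma gives a maximal orthonormal set; a vector of nonzero norm orthogonal to it could be
  normalized and adjoined.\<close>

lemma onb_exists: "\<exists>B. onb M B"
proof -
  let ?A = "{B. orthonormal_family M B (\<lambda>e. e)}"
  have "\<Union>C \<in> ?A" if C: "subset.chain ?A C" for C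
  proof -
    have "l2inner M e e' = (if e = e' then 1 else 0)" if "e \<in> \<Union>C" "e' \<in> \<Union>C" for e e'
    proof -
      from that obtain X Y where XY: "X \<in> C" "Y \<in> C" "e \<in> X" "e' \<in> Y" by blast
      then have "X \<subseteq> Y \<or> Y \<subseteq> X" using C by (auto simp: subset.chain_def)
      then obtain Z where "Z \<in> C" "e \<in> Z" "e' \<in> Z" using XY by blast
      moreover from this have "orthonormal_family M Z (\<lambda>e. e)"
        using C by (auto simp: subset.chain_def)
      ultimately show ?thesis by (auto simp: orthonormal_family_def)
    qed
    moreover have "e \<in> L2 M" if "e \<in> \<Union>C" for e
      using that C by (auto simp: subset.chain_def orthonormal_family_def)
    ultimately show ?thesis unfolding orthonormal_family_def by blast
  qed
  from subset_Zorn'[OF this] obtain B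
    where B: "orthonormal_family M B (\<lambda>e. e)"
      and max: "\<And>X. orthonormal_family M X (\<lambda>e. e) \<Longrightarrow> B \<subseteq> X \<Longrightarrow> X = B"
    by blast
  have "l2norm M e = 1" if "e \<in> B" for e
  proof -
    have "complex_of_real ((l2norm M e)\<^sup>2) = of_real 1"
      using B that l2inner_self[of M e] by (auto simp: orthonormal_family_def)
    then have "(l2norm M e)\<^sup>2 = 1" by (simp only: of_real_eq_iff)
    then show ?thesis using l2norm_nonneg[of M e] by (simp add: power2_eq_1_iff)
  qed
  moreover have "l2norm M f = 0" if f: "f \<in> L2 M" and perp: "\<forall>e\<in>B. l2inner M f e = 0" for f
  proof (rule ccontr)
    assume nz: "l2norm M f \<noteq> 0"
    define c where "c = complex_of_real (1 / l2norm M f)"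
    define u where "u = (\<lambda>x. c * f x)"
    have u: "u \<in> L2 M" "l2inner M u u = 1"
      using normalize_orthonormal[OF f nz] unfolding orthonormal_family_def u_def c_def by auto
    have ue: "l2inner M u e = 0" if "e \<in> B" for e
      using l2inner_lincomb_left[OF f f, of e c 0] B that perp
      by (auto simp: u_def orthonormal_family_def)
    have eu: "l2inner M e u = 0" if "e \<in> B" for e
      using ue[OF that] l2inner_commute[of M e u] by simp
    have "u \<notin> B" using ue u by auto
    moreover have "orthonormal_family M (insert u B) (\<lambda>e. e)"
      using B u ue eu \<open>u \<notin> B\<close> unfolding orthonormal_family_def by auto
    ultimately show False using max[of "insert u B"] by blast
  qed
  ultimately have "onb M B"
    unfolding onb_def using B by (auto simp: orthonormal_family_def)
  then show ?thesis ..
qed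

subsection \<open>Bounded operators and Hilbert--Schmidt norms\<close>

lemma bounded_op_L2: "bounded_op M T \<Longrightarrow> f \<in> L2 M \<Longrightarrow> T f \<in> L2 M"
  unfolding bounded_op_def by blast

lemma bounded_op_AE_cong:
  "bounded_op M T \<Longrightarrow> f \<in> L2 M \<Longrightarrow> g \<in> L2 M \<Longrightarrow> AE x in M. f x = g x \<Longrightarrow>
    AE x in M. T f x = T g x"
  unfolding bounded_op_def by blast

lemma bounded_op_lincomb:
  "bounded_op M T \<Longrightarrow> f \<in> L2 M \<Longrightarrow> g \<in> L2 M \<Longrightarrow>
    AE x in M. T (\<lambda>y. a * f y + b * g y) x = a * T f x + b * T g x"
  unfolding bounded_op_def by blast

lemma bounded_op_bound:
  assumes "bounded_op M T"
  obtains C where "0 \<le> C" "\<And>f. f \<in> L2 M \<Longrightarrow> l2norm M (T f) \<le> C * l2norm M f"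
proof -
  obtain C where "\<And>f. f \<in> L2 M \<Longrightarrow> l2norm M (T f) \<le> C * l2norm M f"
    using assms unfolding bounded_op_def by blast
  then have "l2norm M (T f) \<le> max 0 C * l2norm M f" if "f \<in> L2 M" for f
    using that by (meson l2norm_nonneg max.cobounded2 mult_right_mono order_trans)
  then show ?thesis using that[of "max 0 C"] by simp
qed

lemma bounded_op_diff:
  "bounded_op M T \<Longrightarrow> f \<in> L2 M \<Longrightarrow> g \<in> L2 M \<Longrightarrow>
    AE x in M. T (\<lambda>y. f y - g y) x = T f x - T g x"
  using bounded_op_lincomb[of M T f g 1 "-1"] by simp

lemma bounded_op_sum:
  assumes T: "bounded_op M T" and "finite I" "\<And>i. i \<in> I \<Longrightarrow> f i \<in> L2 M"
  shows "AE x in M. T (\<lambda>y. \<Sum>i\<in>I. c i * f i y) x = (\<Sum>i\<in>I. c i * T (f i) x)"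
  using assms(2,3)
proof (induction rule: finite_induct)
  case empty
  then show ?case using bounded_op_lincomb[OF T L2_zero L2_zero, of 0 0] by simp
next
  case (insert i I)
  have "AE x in M. T (\<lambda>y. \<Sum>i\<in>I. c i * f i y) x = (\<Sum>i\<in>I. c i * T (f i) x)"
    using insert by simp
  moreover have "AE x in M. T (\<lambda>y. c i * f i y + 1 * (\<Sum>i\<in>I. c i * f i y)) x
      = c i * T (f i) x + 1 * T (\<lambda>y. \<Sum>i\<in>I. c i * f i y) x"
    using insert by (intro bounded_op_lincomb[OF T] L2_sum) auto
  ultimately show ?case
    by eventually_elim (use insert in simp)
qed

lemma l2inner_bounded_op_sum:
  assumes T: "bounded_op M T" and I: "finite I" "\<And>i. i \<in> I \<Longrightarrow> f i \<in> L2 M" and g: "g \<in> L2 M"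
  shows "l2inner M (T (\<lambda>y. \<Sum>i\<in>I. c i * f i y)) g = (\<Sum>i\<in>I. c i * l2inner M (T (f i)) g)"
proof -
  have "l2inner M (T (\<lambda>y. \<Sum>i\<in>I. c i * f i y)) g = l2inner M (\<lambda>x. \<Sum>i\<in>I. c i * T (f i) x) g"
    by (intro l2inner_cong_AE bounded_op_L2[OF T] L2_sum I g bounded_op_sum[OF T])
  also have "\<dots> = (\<Sum>i\<in>I. c i * l2inner M (T (f i)) g)"
    by (intro l2inner_sum_left I g bounded_op_L2[OF T])
  finally show ?thesis .
qed

text \<open>Comparing the functional \<open>\<langle>T \<cdot>, g\<rangle>\<close> on two orthonormal systems replaces the passage to the
  adjoint of \<open>T\<close> in the usual proof that Hilbert--Schmidt norms do not depend on the basis.\<close>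

lemma functional_orthonormal_le_onb:
  assumes T: "bounded_op M T" and B: "onb M B" and g: "g \<in> L2 M"
    and I: "finite I" and f: "orthonormal_family M I f"
  shows "(\<Sum>i\<in>I. ennreal ((cmod (l2inner M (T (f i)) g))\<^sup>2))
     \<le> (\<integral>\<^sup>+e. ennreal ((cmod (l2inner M (T e) g))\<^sup>2) \<partial>count_space B)" (is "_ \<le> ?R")
proof (cases "?R = top")
  case False
  define L where "L = enn2real ?R"
  have L: "0 \<le> L" "?R = ennreal L" using False by (auto simp: L_def less_top)
  note o = onb_orthonormal[OF B]
  note fL = orthonormal_family_L2[OF f]
  \<comment> \<open>With these coefficients the functional takes the value \<open>S\<close> at
    \<open>v\<close>, while \<open>S\<close> is also the squared norm of \<open>v\<close>. Expanding
    \<open>v\<close> in \<open>B\<close> bounds \<open>S\<close> by \<open>sqrt S * sqrt L\<close>,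
    and \<open>sqrt S\<close> cancels.\<close>
  define c where "c i = cnj (l2inner M (T (f i)) g)" for i
  define S where "S = (\<Sum>i\<in>I. (cmod (l2inner M (T (f i)) g))\<^sup>2)"
  have S0: "0 \<le> S" by (simp add: S_def sum_nonneg)
  define v where "v = (\<lambda>x. \<Sum>i\<in>I. c i * f i x)"
  have v: "v \<in> L2 M" unfolding v_def by (rule L2_sum[OF I fL])
  have vn: "(l2norm M v)\<^sup>2 = S"
    unfolding v_def l2norm_orthonormal_sum[OF f I] by (simp add: c_def S_def)
  have Tv: "l2inner M (T v) g = complex_of_real S"
  proof -
    have "l2inner M (T v) g = (\<Sum>i\<in>I. c i * l2inner M (T (f i)) g)"
      unfolding v_def by (rule l2inner_bounded_op_sum[OF T I fL g])
    also have "\<dots> = (\<Sum>i\<in>I. complex_of_real ((cmod (l2inner M (T (f i)) g))\<^sup>2))"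
      by (intro sum.cong refl) (simp only: c_def complex_norm_square mult.commute)
    finally show ?thesis by (simp add: S_def)
  qed
  obtain C where C: "0 \<le> C" "\<And>f. f \<in> L2 M \<Longrightarrow> l2norm M (T f) \<le> C * l2norm M f"
    using bounded_op_bound[OF T] by blast
  have "S \<le> sqrt S * sqrt L + \<epsilon>" if "0 < \<epsilon>" for \<epsilon>
  proof -
    \<comment> \<open>An error \<delta> in \<open>v\<close> is amplified by at most
      \<open>C * l2norm M g\<close>; the \<open>+ 1\<close> keeps the denominator positive.\<close>
    define \<delta> where "\<delta> = \<epsilon> / (C * l2norm M g + 1)"
    have nn: "0 \<le> C * l2norm M g" using C by simp
    have \<delta>: "0 < \<delta>" "C * \<delta> * l2norm M g \<le> \<epsilon>"
      using that nn unfolding \<delta>_def by (auto simp: field_simps)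
    from \<delta>(1) have "0 < \<delta>\<^sup>2" by simp
    from onb_approx[OF B v this] obtain E where E: "finite E" "E \<subseteq> B"
      and E': "(l2norm M (\<lambda>x. v x - (\<Sum>e\<in>E. l2inner M v e * e x)))\<^sup>2 < \<delta>\<^sup>2" by blast
    define p where "p = (\<lambda>x. \<Sum>e\<in>E. l2inner M v e * e x)"
    have EL: "e \<in> L2 M" if "e \<in> E" for e using that E onb_L2[OF B] by blast
    have p: "p \<in> L2 M" unfolding p_def by (rule L2_sum[OF E(1) EL])
    have vp: "l2norm M (\<lambda>x. v x - p x) \<le> \<delta>"
      using E' \<delta>(1) by (auto simp: p_def dest: power2_less_imp_less)
    have "cmod (l2inner M (T p) g) = cmod (\<Sum>e\<in>E. l2inner M v e * l2inner M (T e) g)"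
      unfolding p_def using l2inner_bounded_op_sum[OF T E(1) EL g] by simp
    also have "\<dots> \<le> (\<Sum>e\<in>E. \<bar>cmod (l2inner M v e)\<bar> * \<bar>cmod (l2inner M (T e) g)\<bar>)"
      by (rule order_trans[OF norm_sum]) (simp add: norm_mult)
    also have "\<dots> \<le> L2_set (\<lambda>e. cmod (l2inner M v e)) E * L2_set (\<lambda>e. cmod (l2inner M (T e) g)) E"
      by (rule L2_set_mult_ineq)
    also have "\<dots> \<le> sqrt S * sqrt L"
    proof (intro mult_mono)
      show "L2_set (\<lambda>e. cmod (l2inner M v e)) E \<le> sqrt S"
        unfolding L2_set_def using bessel[OF orthonormal_family_subset[OF o E(2)] E(1) v] vn by simp
      have "ennreal (\<Sum>e\<in>E. (cmod (l2inner M (T e) g))\<^sup>2) \<le> ennreal L"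
        unfolding L(2)[symmetric] using sum_le_nn_integral_count_space[OF E] by (simp flip: sum_ennreal)
      then show "L2_set (\<lambda>e. cmod (l2inner M (T e) g)) E \<le> sqrt L"
        unfolding L2_set_def using L by simp
    qed (auto simp: S0 L2_set_nonneg)
    finally have 1: "cmod (l2inner M (T p) g) \<le> sqrt S * sqrt L" .
    have d: "(\<lambda>x. v x - p x) \<in> L2 M" by (rule L2_diff[OF v p])
    have "l2inner M (T (\<lambda>x. v x - p x)) g = l2inner M (\<lambda>x. T v x - T p x) g"
      by (intro l2inner_cong_AE bounded_op_L2[OF T] L2_diff d v p g bounded_op_diff[OF T])
    also have "\<dots> = l2inner M (T v) g - l2inner M (T p) g"
      by (intro l2inner_diff_left bounded_op_L2[OF T] v p g)
    finally have "cmod (l2inner M (T v) g - l2inner M (T p) g)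
        \<le> l2norm M (T (\<lambda>x. v x - p x)) * l2norm M g"
      using l2inner_Cauchy_Schwarz[OF bounded_op_L2[OF T d] g] by simp
    also have "\<dots> \<le> C * \<delta> * l2norm M g"
      using C(2)[OF d] vp C(1) by (intro mult_right_mono order_trans[OF C(2)[OF d]] mult_left_mono) auto
    finally have 2: "cmod (l2inner M (T v) g - l2inner M (T p) g) \<le> \<epsilon>" using \<delta>(2) by simp
    have "S = cmod (l2inner M (T v) g)" using Tv S0 by simp
    also have "\<dots> \<le> cmod (l2inner M (T p) g) + cmod (l2inner M (T v) g - l2inner M (T p) g)"
      using norm_triangle_ineq[of "l2inner M (T p) g" "l2inner M (T v) g - l2inner M (T p) g"] by simp
    finally show ?thesis using 1 2 by linarith
  qed
  then have "S \<le> sqrt S * sqrt L" by (rule field_le_epsilon)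
  then have "sqrt S * sqrt S \<le> sqrt S * sqrt L" using S0 by simp
  then have "S \<le> L"
  proof (cases "S = 0")
    case False
    then have "0 < sqrt S" using S0 by simp
    then show ?thesis
      using \<open>sqrt S * sqrt S \<le> sqrt S * sqrt L\<close> by (simp only: mult_le_cancel_left_pos real_sqrt_le_iff)
  qed (simp add: L)
  then show ?thesis unfolding L(2) S_def by (simp add: sum_ennreal ennreal_leI)
qed simp

text \<open>Parseval's identity in the range splits each squared norm into the functionals of the
  preceding lemma, which is applied to one \<open>g\<close> at a time. The two sums over
  \<open>B\<close> are then interchanged as an inequality, through finite subsets of the outer index
  set.\<close>

lemma orthonormal_hs_le_onb:
  assumes T: "bounded_op M T" and B: "onb M B"
    and I: "finite I" and f: "orthonormal_family M I f"
  shows "(\<Sum>i\<in>I. ennreal ((l2norm M (T (f i)))\<^sup>2))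
     \<le> (\<integral>\<^sup>+e. ennreal ((l2norm M (T e))\<^sup>2) \<partial>count_space B)"
proof -
  let ?h = "\<lambda>u g. ennreal ((cmod (l2inner M (T u) g))\<^sup>2)"
  have par: "ennreal ((l2norm M (T u))\<^sup>2) = (\<integral>\<^sup>+g. ?h u g \<partial>count_space B)" if "u \<in> L2 M" for u
    by (rule parseval[OF B bounded_op_L2[OF T that], symmetric])
  have "(\<Sum>i\<in>I. ennreal ((l2norm M (T (f i)))\<^sup>2)) = (\<Sum>i\<in>I. \<integral>\<^sup>+g. ?h (f i) g \<partial>count_space B)"
    by (intro sum.cong refl par orthonormal_family_L2[OF f])
  also have "\<dots> = (\<integral>\<^sup>+g. (\<Sum>i\<in>I. ?h (f i) g) \<partial>count_space B)"
    by (rule nn_integral_sum[symmetric]) simp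
  also have "\<dots> \<le> (\<integral>\<^sup>+g. (\<integral>\<^sup>+e. ?h e g \<partial>count_space B) \<partial>count_space B)"
    using onb_L2[OF B] by (intro nn_integral_mono functional_orthonormal_le_onb[OF T B _ I f]) auto
  also have "\<dots> \<le> (\<integral>\<^sup>+e. (\<integral>\<^sup>+g. ?h e g \<partial>count_space B) \<partial>count_space B)"
  proof (rule nn_integral_count_space_le)
    fix G assume G: "finite G" "G \<subseteq> B"
    have "(\<Sum>g\<in>G. \<integral>\<^sup>+e. ?h e g \<partial>count_space B) = (\<integral>\<^sup>+e. (\<Sum>g\<in>G. ?h e g) \<partial>count_space B)"
      by (rule nn_integral_sum[symmetric]) simp
    also have "\<dots> \<le> (\<integral>\<^sup>+e. (\<integral>\<^sup>+g. ?h e g \<partial>count_space B) \<partial>count_space B)"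
      by (intro nn_integral_mono sum_le_nn_integral_count_space G)
    finally show "(\<Sum>g\<in>G. \<integral>\<^sup>+e. ?h e g \<partial>count_space B)
      \<le> (\<integral>\<^sup>+e. (\<integral>\<^sup>+g. ?h e g \<partial>count_space B) \<partial>count_space B)" .
  qed
  also have "\<dots> = (\<integral>\<^sup>+e. ennreal ((l2norm M (T e))\<^sup>2) \<partial>count_space B)"
    using onb_L2[OF B] by (intro nn_integral_cong) (simp add: par)
  finally show ?thesis .
qed

section \<open>Restriction and composition of operators; operator norm against Hilbert-Schmidt
  norm\<close>

lemma bounded_op_indicator_comp:
  assumes A: "A \<in> sets M" and R: "bounded_op M R"
  shows "bounded_op M (\<lambda>f x. indicator A x * R f x)"
proof -
  obtain C where C: "\<And>f. f \<in> L2 M \<Longrightarrow> l2norm M (R f) \<le> C * l2norm M f"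
    using bounded_op_bound[OF R] by blast
  have le: "l2norm M (\<lambda>x. indicator A x * R f x) \<le> l2norm M (R f)" if f: "f \<in> L2 M" for f
    unfolding l2norm_def
    by (intro real_sqrt_le_mono integral_mono L2_integrable L2_indicator_mult A bounded_op_L2[OF R f])
      (simp add: indicator_def)
  show ?thesis
    unfolding bounded_op_def
  proof (intro conjI ballI allI impI exI)
    fix f assume f: "f \<in> L2 M"
    show "(\<lambda>x. indicator A x * R f x) \<in> L2 M" by (rule L2_indicator_mult[OF A bounded_op_L2[OF R f]])
    show "l2norm M (\<lambda>x. indicator A x * R f x) \<le> C * l2norm M f"
      by (rule order_trans[OF le[OF f] C[OF f]])
  next
    fix f g assume "f \<in> L2 M" "g \<in> L2 M" "AE x in M. f x = g x"
    from bounded_op_AE_cong[OF R this]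
    show "AE x in M. indicator A x * R f x = indicator A x * R g x" by eventually_elim simp
  next
    fix f g a b assume fg: "f \<in> L2 M" "g \<in> L2 M"
    show "AE x in M. indicator A x * R (\<lambda>y. a * f y + b * g y) x
        = a * (indicator A x * R f x) + b * (indicator A x * R g x)"
      using bounded_op_lincomb[OF R fg, of a b] by eventually_elim (simp add: algebra_simps)
  qed
qed

lemma bounded_op_comp:
  assumes P: "bounded_op M P" and R: "bounded_op M R"
  shows "bounded_op M (P \<circ> R)"
proof -
  obtain C where C: "0 \<le> C" "\<And>f. f \<in> L2 M \<Longrightarrow> l2norm M (P f) \<le> C * l2norm M f"
    using bounded_op_bound[OF P] by blast
  obtain D where D: "\<And>f. f \<in> L2 M \<Longrightarrow> l2norm M (R f) \<le> D * l2norm M f"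
    using bounded_op_bound[OF R] by blast
  note RL = bounded_op_L2[OF R]
  show ?thesis
    unfolding bounded_op_def o_apply
  proof (intro conjI ballI allI impI exI)
    fix f assume f: "f \<in> L2 M"
    show "P (R f) \<in> L2 M" by (rule bounded_op_L2[OF P RL[OF f]])
    show "l2norm M (P (R f)) \<le> (C * D) * l2norm M f"
      using order_trans[OF C(2)[OF RL[OF f]] mult_left_mono[OF D[OF f] C(1)]] by (simp add: mult.assoc)
  next
    fix f g assume fg: "f \<in> L2 M" "g \<in> L2 M" "AE x in M. f x = g x"
    show "AE x in M. P (R f) x = P (R g) x"
      by (rule bounded_op_AE_cong[OF P RL RL bounded_op_AE_cong[OF R]]) fact+
  next
    fix f g a b assume fg: "f \<in> L2 M" "g \<in> L2 M"
    have "AE x in M. P (R (\<lambda>y. a * f y + b * g y)) x = P (\<lambda>x. a * R f x + b * R g x) x"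
      by (intro bounded_op_AE_cong[OF P] bounded_op_lincomb[OF R] RL L2_lincomb fg)
    moreover have "AE x in M. P (\<lambda>x. a * R f x + b * R g x) x = a * P (R f) x + b * P (R g) x"
      by (intro bounded_op_lincomb[OF P] RL fg)
    ultimately show "AE x in M. P (R (\<lambda>y. a * f y + b * g y)) x = a * P (R f) x + b * P (R g) x"
      by eventually_elim simp
  qed
qed

text \<open>The chosen basis depends on \<open>M\<close> alone, so one \<open>B\<close> serves all
  operators at once and their Hilbert-Schmidt sums can be compared term by term.\<close>

lemma hs_norm_sq_onb:
  obtains B where "onb M B"
    "\<And>T. hs_norm_sq M T = (\<integral>\<^sup>+e. ennreal ((l2norm M (T e))\<^sup>2) \<partial>count_space B)"
  using someI_ex[OF onb_exists[of M]] that[of "SOME B. onb M B"] by (simp add: hs_norm_sq_def)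

text \<open>A normalized \<open>f\<close> is a one-element orthonormal family, so the comparison
  with a basis bounds \<open>T f\<close> directly, without completing \<open>f\<close> to a basis.
  If \<open>f\<close> has norm zero, boundedness makes \<open>T f\<close> have norm zero.\<close>

lemma l2norm_le_hs_norm:
  assumes T: "bounded_op M T" and f: "f \<in> L2 M" "l2norm M f \<le> 1"
  shows "ennreal (l2norm M (T f)) \<le> hs_norm M T"
proof (cases "hs_norm_sq M T = \<infinity>")
  case False
  define H where "H = enn2real (hs_norm_sq M T)"
  have H: "0 \<le> H" "hs_norm_sq M T = ennreal H"
    using False by (auto simp: H_def less_top)
  have "l2norm M (T f) \<le> sqrt H"
  proof (cases "l2norm M f = 0")
    case True
    obtain C where "\<And>f. f \<in> L2 M \<Longrightarrow> l2norm M (T f) \<le> C * l2norm M f"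
      using bounded_op_bound[OF T] by blast
    from this[OF f(1)] show ?thesis
      using True order_trans[of _ 0 "sqrt H"] H(1) by simp
  next
    case nz: False
    obtain B where B: "onb M B"
      and hs: "hs_norm_sq M T = (\<integral>\<^sup>+e. ennreal ((l2norm M (T e))\<^sup>2) \<partial>count_space B)"
      using hs_norm_sq_onb by metis
    define c where "c = complex_of_real (1 / l2norm M f)"
    define n where "n = l2norm M f"
    have n: "0 < n" "n \<le> 1" using nz f(2) l2norm_nonneg[of M f] by (auto simp: n_def less_le)
    have cf: "(\<lambda>x. c * f x) \<in> L2 M" by (rule L2_scale[OF f(1)])
    have "ennreal ((l2norm M (T (\<lambda>x. c * f x)))\<^sup>2) \<le> ennreal H"
      using orthonormal_hs_le_onb[OF T B _ normalize_orthonormal[OF f(1) nz]] H(2) hs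
      by (simp only: c_def) simp
    then have "l2norm M (T (\<lambda>x. c * f x)) \<le> sqrt H"
      using H(1) by (simp add: real_le_rsqrt)
    moreover have "l2norm M (T (\<lambda>x. c * f x)) = l2norm M (\<lambda>x. c * T f x)"
      using bounded_op_lincomb[OF T f(1) f(1), of c 0]
      by (intro l2norm_cong_AE bounded_op_L2[OF T] cf L2_scale f) simp
    moreover have "l2norm M (\<lambda>x. c * T f x) = l2norm M (T f) / n"
      unfolding l2norm_scale c_def norm_of_real n_def by simp
    ultimately have "l2norm M (T f) \<le> sqrt H * n"
      using n(1) by (simp add: pos_divide_le_eq)
    also have "\<dots> \<le> sqrt H * 1" using n(2) H(1) by (intro mult_left_mono) auto
    finally show ?thesis by simp
  qed
  then show ?thesis using False by (simp add: hs_norm_def H_def ennreal_leI)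
qed (simp add: hs_norm_def)

lemma op_norm_le_hs_norm:
  assumes T: "bounded_op M T"
  shows "ennreal (op_norm M T) \<le> hs_norm M T"
proof (cases "hs_norm M T = \<infinity>")
  case False
  then have "hs_norm M T = ennreal (enn2real (hs_norm M T))" by (simp add: less_top)
  moreover have "op_norm M T \<le> enn2real (hs_norm M T)"
    unfolding op_norm_def
  proof (rule cSup_least)
    show "{l2norm M (T f) |f. f \<in> L2 M \<and> l2norm M f \<le> 1} \<noteq> {}"
      using L2_zero[of M] by (auto simp: l2norm_def intro!: exI[of _ "\<lambda>_. 0"])
    fix r assume "r \<in> {l2norm M (T f) |f. f \<in> L2 M \<and> l2norm M f \<le> 1}"
    then obtain f where f: "f \<in> L2 M" "l2norm M f \<le> 1" and r: "r = l2norm M (T f)" by blast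
    have "ennreal r \<le> ennreal (enn2real (hs_norm M T))"
      using l2norm_le_hs_norm[OF T f] \<open>hs_norm M T = ennreal _\<close> r by simp
    then show "r \<le> enn2real (hs_norm M T)" by simp
  qed
  ultimately show ?thesis by (metis ennreal_leI)
qed simp

text \<open>Linearity settles simple functions, starting from the constant 1, which is
  square-integrable because the measure is finite. For general \<open>f\<close>, simple functions
  \<open>F i\<close> are chosen such that \<open>P (F i)\<close> tends to \<open>P f\<close> in norm
  and to \<open>f\<close> times \<open>P 1\<close> almost everywhere.\<close>

lemma commutes_indicators_imp_multiplication:
  assumes fin: "finite_measure M" and P: "bounded_op M P"
    and comm: "\<And>S f. S \<in> sets M \<Longrightarrow> f \<in> L2 M \<Longrightarrow>
      AE x in M. P (\<lambda>y. indicator S y * f y) x = indicator S x * P f x"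
    and f: "f \<in> L2 M"
  shows "AE x in M. P f x = f x * P (\<lambda>_. 1) x"
proof -
  interpret finite_measure M by fact
  have one: "(\<lambda>_. 1) \<in> L2 M" by (simp add: L2_def)
  have simple: "AE x in M. P s x = s x * P (\<lambda>_. 1) x" if s: "simple_function M s" "s \<in> L2 M" for s
  proof -
    define I where "I = s ` space M"
    define S where "S y = s -` {y} \<inter> space M" for y
    have I: "finite I" unfolding I_def by (rule simple_functionD(1)[OF s(1)])
    have S: "S y \<in> sets M" for y unfolding S_def by (rule simple_functionD(2)[OF s(1)])
    have ind: "(\<lambda>x. indicator (S y) x * 1) \<in> L2 M" for y
      by (rule L2_indicator_mult[OF S one])
    have rep: "s x = (\<Sum>y\<in>I. y * (indicator (S y) x * 1))" if "x \<in> space M" for x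
    proof -
      have "s x = (\<Sum>y\<in>I. indicator (S y) x *\<^sub>R y)"
        unfolding I_def S_def by (rule simple_function_indicator_representation_banach[OF s(1) that])
      also have "\<dots> = (\<Sum>y\<in>I. y * (indicator (S y) x * 1))"
        by (intro sum.cong refl) (simp add: indicator_def)
      finally show ?thesis .
    qed
    have "AE x in M. P s x = P (\<lambda>x. \<Sum>y\<in>I. y * (indicator (S y) x * 1)) x"
      by (rule bounded_op_AE_cong[OF P s(2) L2_sum[OF I ind]]) (rule AE_I2, rule rep)
    moreover have "AE x in M. P (\<lambda>x. \<Sum>y\<in>I. y * (indicator (S y) x * 1)) x
        = (\<Sum>y\<in>I. y * P (\<lambda>x. indicator (S y) x * 1) x)"
      by (rule bounded_op_sum[OF P I ind])
    moreover have "AE x in M. \<forall>y\<in>I. P (\<lambda>x. indicator (S y) x * 1) x = indicator (S y) x * P (\<lambda>_. 1) x"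
      using comm[OF S one] by (subst AE_finite_all[OF I]) blast
    ultimately show ?thesis using AE_space
    proof eventually_elim
      case (elim x)
      have "P s x = (\<Sum>y\<in>I. y * (indicator (S y) x * P (\<lambda>_. 1) x))"
        unfolding elim(1,2) by (intro sum.cong refl) (simp only: elim(3)[rule_format])
      also have "\<dots> = (\<Sum>y\<in>I. y * (indicator (S y) x * 1)) * P (\<lambda>_. 1) x"
        by (simp add: sum_distrib_right mult.assoc)
      finally show ?case unfolding rep[OF elim(4), symmetric] .
    qed
  qed
  note [measurable] = L2_measurable[OF f] L2_measurable[OF bounded_op_L2[OF P f]]
    L2_measurable[OF bounded_op_L2[OF P one]]
  obtain F where F: "\<And>i. simple_function M (F i)"
    and lim: "\<And>x. x \<in> space M \<Longrightarrow> (\<lambda>i. F i x) \<longlonglongrightarrow> f x"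
    and bound: "\<And>i x. x \<in> space M \<Longrightarrow> cmod (F i x) \<le> 2 * cmod (f x)"
    using borel_measurable_implies_sequence_metric[OF L2_measurable[OF f], of 0] by simp metis
  note [measurable] = borel_measurable_simple_function[OF F]
  have FL: "F i \<in> L2 M" for i
  proof -
    have "integrable M (\<lambda>x. (cmod (F i x))\<^sup>2)"
    proof (rule Bochner_Integration.integrable_bound)
      show "integrable M (\<lambda>x. 4 * (cmod (f x))\<^sup>2)" by (intro integrable_mult_right L2_integrable f)
      show "AE x in M. norm ((cmod (F i x))\<^sup>2) \<le> norm (4 * (cmod (f x))\<^sup>2)"
        using power_mono[OF bound norm_ge_zero, of _ i 2] by (auto simp: power_mult_distrib)
    qed simp
    then show ?thesis by (simp add: L2_def)
  qed
  have "(\<lambda>i. \<integral>x. (cmod (F i x - f x))\<^sup>2 \<partial>M) \<longlonglongrightarrow> (\<integral>x. 0 \<partial>M)"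
  \<comment> \<open>The approximants satisfy \<open>cmod (F i x) \<le> 2 * cmod (f x)\<close>, so
    the difference is at most \<open>3 * cmod (f x)\<close>; squaring gives the factor 9.\<close>
  proof (rule integral_dominated_convergence[where w = "\<lambda>x. 9 * (cmod (f x))\<^sup>2"])
    show "integrable M (\<lambda>x. 9 * (cmod (f x))\<^sup>2)" by (intro integrable_mult_right L2_integrable f)
    show "AE x in M. (\<lambda>i. (cmod (F i x - f x))\<^sup>2) \<longlonglongrightarrow> 0"
    proof (rule AE_I2)
      fix x assume "x \<in> space M"
      then have "(\<lambda>i. (cmod (F i x - f x))\<^sup>2) \<longlonglongrightarrow> (cmod (f x - f x))\<^sup>2"
        by (intro tendsto_intros lim)
      then show "(\<lambda>i. (cmod (F i x - f x))\<^sup>2) \<longlonglongrightarrow> 0" by simp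
    qed
    show "AE x in M. norm ((cmod (F i x - f x))\<^sup>2) \<le> 9 * (cmod (f x))\<^sup>2" for i
    proof (rule AE_I2)
      fix x assume "x \<in> space M"
      then have "cmod (F i x - f x) \<le> 3 * cmod (f x)"
        using norm_triangle_ineq4[of "F i x" "f x"] bound[of x i] by linarith
      from power_mono[OF this norm_ge_zero, of 2]
      show "norm ((cmod (F i x - f x))\<^sup>2) \<le> 9 * (cmod (f x))\<^sup>2" by (simp add: power_mult_distrib)
    qed
  qed simp_all
  then have lim0: "(\<lambda>i. (l2norm M (\<lambda>x. F i x - f x))\<^sup>2) \<longlonglongrightarrow> 0" by (simp add: l2norm_sq)
  obtain C where C: "0 \<le> C" "\<And>f. f \<in> L2 M \<Longrightarrow> l2norm M (P f) \<le> C * l2norm M f"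
    using bounded_op_bound[OF P] by blast
  define d where "d i = (\<lambda>x. P (F i) x - P f x)" for i
  have dL: "d i \<in> L2 M" for i unfolding d_def by (intro L2_diff bounded_op_L2[OF P] FL f)
  have d: "(l2norm M (d i))\<^sup>2 \<le> C\<^sup>2 * (l2norm M (\<lambda>x. F i x - f x))\<^sup>2" for i
  proof -
    have "l2norm M (d i) = l2norm M (P (\<lambda>x. F i x - f x))"
      by (rule l2norm_cong_AE[OF dL bounded_op_L2[OF P L2_diff[OF FL f]]])
        (use bounded_op_diff[OF P FL f, of i] in eventually_elim, simp add: d_def)
    then have "l2norm M (d i) \<le> C * l2norm M (\<lambda>x. F i x - f x)" using C(2)[OF L2_diff[OF FL f]] by simp
    from power_mono[OF this l2norm_nonneg, of 2] show ?thesis by (simp add: power_mult_distrib)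
  qed
  have dlim: "(\<lambda>i. (l2norm M (d i))\<^sup>2) \<longlonglongrightarrow> 0"
  proof (rule tendsto_sandwich[OF _ _ tendsto_const])
    show "\<forall>\<^sub>F i in sequentially. 0 \<le> (l2norm M (d i))\<^sup>2" by simp
    show "\<forall>\<^sub>F i in sequentially. (l2norm M (d i))\<^sup>2 \<le> C\<^sup>2 * (l2norm M (\<lambda>x. F i x - f x))\<^sup>2"
      by (intro always_eventually allI d)
    show "(\<lambda>i. C\<^sup>2 * (l2norm M (\<lambda>x. F i x - f x))\<^sup>2) \<longlonglongrightarrow> 0"
      using tendsto_mult[OF tendsto_const lim0, of "C\<^sup>2"] by simp
  qed
  have "AE x in M. \<forall>i. P (F i) x = F i x * P (\<lambda>_. 1) x"
    using simple[OF F FL] by (simp add: AE_all_countable)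
  then have ae: "AE x in M. (\<lambda>i. d i x) \<longlonglongrightarrow> f x * P (\<lambda>_. 1) x - P f x"
    using AE_space by eventually_elim (auto simp: d_def intro!: tendsto_intros lim)
  have g: "(\<lambda>x. f x * P (\<lambda>_. 1) x - P f x) \<in> borel_measurable M" by simp
  \<comment> \<open>The \<open>d i\<close> tend to 0 in norm. Fatou's lemma with every \<epsilon>
    then makes their almost everywhere limit zero without extracting a subsequence, and with the
    bound 1 it first shows that this limit is square-integrable.\<close>
  have ev: "eventually (\<lambda>i. (l2norm M (d i))\<^sup>2 \<le> \<epsilon>) sequentially" if "0 < \<epsilon>" for \<epsilon>
    using order_tendstoD(2)[OF dlim that] by eventually_elim simp
  have gL: "(\<lambda>x. f x * P (\<lambda>_. 1) x - P f x) \<in> L2 M"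
    by (rule L2_Fatou(1)[OF dL g ae ev[OF zero_less_one]])
  have "(l2norm M (\<lambda>x. f x * P (\<lambda>_. 1) x - P f x))\<^sup>2 \<le> 0"
  proof (rule field_le_epsilon)
    fix \<epsilon> :: real assume "0 < \<epsilon>"
    then show "(l2norm M (\<lambda>x. f x * P (\<lambda>_. 1) x - P f x))\<^sup>2 \<le> 0 + \<epsilon>"
      using L2_Fatou(2)[OF dL g ae ev] by simp
  qed
  then have "l2norm M (\<lambda>x. f x * P (\<lambda>_. 1) x - P f x) = 0" by simp
  then have "AE x in M. f x * P (\<lambda>_. 1) x - P f x = 0" using l2norm_eq_0_iff[OF gL] by blast
  then show ?thesis by eventually_elim simp
qed

subsection \<open>Haar measure on a compact group\<close>

text \<open>Compactness covers \<open>K\<close> by finitely many open boxes inside \<open>U\<close>,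
  and a finite union of boxes lies in the product sigma-algebra even when \<open>U\<close> itself
  does not.\<close>

lemma pair_measurable_between_compact_open:
  fixes K U :: "('a::topological_space \<times> 'b::topological_space) set"
  assumes K: "compact K" and U: "open U" and "K \<subseteq> U"
  obtains W where "W \<in> sets (borel \<Otimes>\<^sub>M borel)" "K \<subseteq> W" "W \<subseteq> U"
proof -
  have "\<forall>p\<in>K. \<exists>A B. open A \<and> open B \<and> p \<in> A \<times> B \<and> A \<times> B \<subseteq> U"
    using U \<open>K \<subseteq> U\<close> unfolding open_prod_def by blast
  then obtain A B where AB: "\<And>p. p \<in> K \<Longrightarrow> open (A p) \<and> open (B p) \<and> p \<in> A p \<times> B p \<and> A p \<times> B p \<subseteq> U"
    by metis
  have op: "open (A p \<times> B p)" if "p \<in> K" for p using AB[OF that] by (intro open_Times) auto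
  have cover: "K \<subseteq> (\<Union>p\<in>K. A p \<times> B p)" using AB by blast
  obtain C where C: "C \<subseteq> K" "finite C" "K \<subseteq> (\<Union>p\<in>C. A p \<times> B p)"
    by (rule compactE_image[OF K op cover])
  show ?thesis
  proof (rule that)
    show "(\<Union>p\<in>C. A p \<times> B p) \<in> sets (borel \<Otimes>\<^sub>M borel)"
      using C AB by (intro sets.finite_UN) (auto intro!: pair_measureI borel_open)
    show "K \<subseteq> (\<Union>p\<in>C. A p \<times> B p)" by fact
    show "(\<Union>p\<in>C. A p \<times> B p) \<subseteq> U" using C(1) AB by blast
  qed
qed

text \<open>Without second countability the product of the Borel \<open>\<sigma>\<close>-algebras can be strictly smaller than
  the Borel \<open>\<sigma>\<close>-algebra of the product, so this does not hold for arbitrary Borel functions; hence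
  Fubini is applied to continuous functions only.\<close>

lemma continuous_imp_pair_borel_measurable:
  fixes f :: "'a::topological_space \<times> 'b::topological_space \<Rightarrow> real"
  assumes f: "continuous_on UNIV f" and c: "compact (UNIV :: 'a set)" "compact (UNIV :: 'b set)"
  shows "f \<in> borel_measurable (borel \<Otimes>\<^sub>M borel)"
proof (rule borel_measurableI_greater)
  fix a
  \<comment> \<open>The open superlevel set is the union of these compact sets; a measurable
    \<open>W n\<close> between each of them and the superlevel set makes it a countable union of
    measurable sets.\<close>
  let ?K = "\<lambda>n::nat. {p. a + 1 / Suc n \<le> f p}"
  have cU: "compact (UNIV :: ('a \<times> 'b) set)"
    using compact_Times[OF c] by simp
  have K: "compact (?K n)" for n
  proof -
    have "closed (?K n)" by (intro closed_Collect_le continuous_intros f)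
    from compact_Int_closed[OF cU this] show ?thesis by simp
  qed
  have U: "open {p. a < f p}" by (intro open_Collect_less continuous_intros f)
  have "\<exists>W. W \<in> sets (borel \<Otimes>\<^sub>M borel) \<and> ?K n \<subseteq> W \<and> W \<subseteq> {p. a < f p}" for n
  proof -
    have "?K n \<subseteq> {p. a < f p}"
    proof
      fix p assume "p \<in> ?K n"
      moreover have "0 < 1 / real (Suc n)" by simp
      ultimately show "p \<in> {p. a < f p}" unfolding mem_Collect_eq by linarith
    qed
    from pair_measurable_between_compact_open[OF K U this] show ?thesis by metis
  qed
  then obtain W where W: "\<And>n. W n \<in> sets (borel \<Otimes>\<^sub>M borel)" "\<And>n. ?K n \<subseteq> W n" "\<And>n. W n \<subseteq> {p. a < f p}"
    by metis
  have "{p. a < f p} \<subseteq> (\<Union>n. W n)"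
  proof
    fix p assume "p \<in> {p. a < f p}"
    then obtain n where "inverse (real (Suc n)) < f p - a"
      using reals_Archimedean[of "f p - a"] by auto
    then have "p \<in> ?K n" by (simp add: inverse_eq_divide)
    then show "p \<in> (\<Union>n. W n)" using W(2) by blast
  qed
  then have "{p \<in> space (borel \<Otimes>\<^sub>M borel). a < f p} = (\<Union>n. W n)"
    using W(3) by (auto simp: space_pair_measure)
  then show "{p \<in> space (borel \<Otimes>\<^sub>M borel). a < f p} \<in> sets (borel \<Otimes>\<^sub>M borel)"
    using W(1) by auto
qed

section \<open>Translation invariance, regularity and averaging over translates\<close>

locale compact_haar_group =
  fixes M :: "'g::{group_add, t2_space} measure"
  assumes continuous_plus: "continuous_on UNIV (\<lambda>p::'g \<times> 'g. fst p + snd p)"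
    and continuous_uminus: "continuous_on UNIV (uminus :: 'g \<Rightarrow> 'g)"
    and compact_group: "compact (UNIV :: 'g set)"
    and haar: "haar_prob M"
begin

lemma sets_M [measurable_cong]: "sets M = sets borel"
  using haar by (simp add: haar_prob_def)

lemma space_M [simp]: "space M = UNIV"
  using sets_eq_imp_space_eq[OF sets_M] by simp

lemma emeasure_UNIV [simp]: "emeasure M UNIV = 1"
  using haar by (simp add: haar_prob_def)

sublocale finite_measure M
  by (rule finite_measureI) simp

lemma continuous_add:
  assumes "continuous_on S f" "continuous_on S g"
  shows "continuous_on S (\<lambda>x. f x + g x :: 'g)"
  using continuous_on_compose2[OF continuous_plus continuous_on_Pair[OF assms]] by simp

lemma continuous_neg: "continuous_on S f \<Longrightarrow> continuous_on S (\<lambda>x. - f x :: 'g)"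
  using continuous_on_compose2[OF continuous_uminus] by blast

lemma continuous_imp_measurable_M: "continuous_on UNIV f \<Longrightarrow> f \<in> M \<rightarrow>\<^sub>M borel"
  by (subst measurable_cong_sets[OF sets_M refl]) (rule borel_measurable_continuous_onI)

lemma measurable_plus_left [measurable]: "(\<lambda>y. a + y) \<in> M \<rightarrow>\<^sub>M M"
  unfolding measurable_cong_sets[OF refl sets_M]
  by (intro continuous_imp_measurable_M continuous_add continuous_intros)

lemma distr_plus_left: "distr M M (\<lambda>y. a + y) = M"
proof (rule measure_eqI)
  fix A assume "A \<in> sets (distr M M (\<lambda>y. a + y))"
  then have A: "A \<in> sets M" by simp
  \<comment> \<open>\<open>haar_prob\<close> states invariance for images, whereas
    \<open>distr\<close> is computed with preimages.\<close>
  have "(\<lambda>y. a + y) -` A = (\<lambda>y. - a + y) ` A"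
  proof (intro equalityI subsetI)
    fix y assume "y \<in> (\<lambda>y. a + y) -` A"
    then show "y \<in> (\<lambda>y. - a + y) ` A"
      by (intro image_eqI[of _ _ "a + y"]) (auto simp: add.assoc[symmetric])
  qed (auto simp: add.assoc[symmetric])
  then show "emeasure (distr M M (\<lambda>y. a + y)) A = emeasure M A"
    using A haar by (simp add: emeasure_distr haar_prob_def)
qed simp

lemma nn_integral_plus_left:
  assumes "f \<in> borel_measurable M"
  shows "(\<integral>\<^sup>+y. f (a + y) \<partial>M) = (\<integral>\<^sup>+y. f y \<partial>M)"
  using nn_integral_distr[OF measurable_plus_left[of a], of f] assms by (simp add: distr_plus_left)

lemma l2inner_plus_left:
  assumes f: "f \<in> L2 M" and g: "g \<in> L2 M"
  shows "l2inner M (\<lambda>y. f (a + y)) (\<lambda>y. g (a + y)) = l2inner M f g"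
  using integral_distr[OF measurable_plus_left[of a] borel_measurable_integrable[OF L2_inner_integrable[OF f g]]]
  by (simp add: l2inner_def distr_plus_left)

lemma L2_plus_left:
  assumes f: "f \<in> L2 M"
  shows "(\<lambda>y. f (a + y)) \<in> L2 M"
proof -
  have "integrable (distr M M (\<lambda>y. a + y)) (\<lambda>x. (cmod (f x))\<^sup>2)"
    using L2_integrable[OF f] by (simp add: distr_plus_left)
  then have "integrable M (\<lambda>y. (cmod (f (a + y)))\<^sup>2)"
    by (rule integrable_distr[OF measurable_plus_left])
  then show ?thesis
    using measurable_compose[OF measurable_plus_left L2_measurable[OF f]] by (simp add: L2_def)
qed

text \<open>After Tonelli, the substitution of \<open>y + x\<close> for \<open>x\<close> shows that
  the integral over \<open>x\<close> is a constant \<open>J\<close> independent of \<open>y\<close>.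
  That \<open>J\<close> equals the integral of \<open>u\<close> is invariance under inversion; it
  follows from the case of the constant function 1 and total mass 1.\<close>

lemma nn_integral_convolution_continuous:
  fixes u :: "'g \<Rightarrow> real"
  assumes u: "continuous_on UNIV u" and h [measurable]: "h \<in> borel_measurable M"
  shows "(\<integral>\<^sup>+x. (\<integral>\<^sup>+y. ennreal (u (- x + y)) * h y \<partial>M) \<partial>M) = (\<integral>\<^sup>+y. ennreal (u y) \<partial>M) * (\<integral>\<^sup>+y. h y \<partial>M)"
proof -
  interpret pair_sigma_finite M M ..
  have [measurable]: "u \<in> borel_measurable M" by (rule continuous_imp_measurable_M[OF u])
  have "continuous_on UNIV (\<lambda>p. u (- fst p + snd p))"
    by (rule continuous_on_compose2[OF u])
      (auto intro!: continuous_add continuous_neg continuous_intros)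
  from continuous_imp_pair_borel_measurable[OF this compact_group compact_group]
  have m [measurable]: "(\<lambda>p. u (- fst p + snd p)) \<in> borel_measurable (M \<Otimes>\<^sub>M M)"
    by (simp add: measurable_cong_sets[OF sets_pair_measure_cong[OF sets_M sets_M] refl])
  define J where "J = (\<integral>\<^sup>+x. ennreal (u (- x)) \<partial>M)"
  have J: "(\<integral>\<^sup>+x. ennreal (u (- x + y)) \<partial>M) = J" for y
  proof -
    have "continuous_on UNIV (\<lambda>x. u (- x + y))"
      by (rule continuous_on_compose2[OF u]) (auto intro!: continuous_add continuous_neg continuous_intros)
    then have [measurable]: "(\<lambda>x. u (- x + y)) \<in> borel_measurable M" by (rule continuous_imp_measurable_M)
    have "(\<integral>\<^sup>+x. ennreal (u (- x + y)) \<partial>M) = (\<integral>\<^sup>+x. ennreal (u (- (y + x) + y)) \<partial>M)"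
      by (rule nn_integral_plus_left[symmetric]) simp
    then show ?thesis by (simp add: J_def minus_add add.assoc)
  qed
  have eq: "(\<integral>\<^sup>+x. (\<integral>\<^sup>+y. ennreal (u (- x + y)) * k y \<partial>M) \<partial>M) = J * (\<integral>\<^sup>+y. k y \<partial>M)"
    if k [measurable]: "k \<in> borel_measurable M" for k
  proof -
    have mx: "(\<lambda>x. u (- x + y)) \<in> borel_measurable M" for y
      using measurable_compose[OF _ m, of "\<lambda>x. (x, y)" M] by simp
    have "(\<integral>\<^sup>+x. (\<integral>\<^sup>+y. ennreal (u (- x + y)) * k y \<partial>M) \<partial>M)
        = (\<integral>\<^sup>+y. (\<integral>\<^sup>+x. ennreal (u (- x + y)) * k y \<partial>M) \<partial>M)"
    proof (rule Fubini'[symmetric])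
      have "(\<lambda>p. ennreal (u (- fst p + snd p)) * k (snd p)) \<in> borel_measurable (M \<Otimes>\<^sub>M M)" by simp
      then show "(\<lambda>(x, y). ennreal (u (- x + y)) * k y) \<in> borel_measurable (M \<Otimes>\<^sub>M M)"
        by (simp add: case_prod_beta')
    qed
    also have "\<dots> = (\<integral>\<^sup>+y. J * k y \<partial>M)"
      using mx by (intro nn_integral_cong) (simp add: nn_integral_multc J)
    also have "\<dots> = J * (\<integral>\<^sup>+y. k y \<partial>M)" by (rule nn_integral_cmult[OF k])
    finally show ?thesis .
  qed
  have "(\<integral>\<^sup>+y. ennreal (u (- x + y)) \<partial>M) = (\<integral>\<^sup>+y. ennreal (u y) \<partial>M)" for x
    by (rule nn_integral_plus_left) simp
  then have "(\<integral>\<^sup>+y. ennreal (u y) \<partial>M) = J"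
    using eq[of "\<lambda>_. 1"] by simp
  then show ?thesis using eq[OF h] by simp
qed

text \<open>Outer regularity gives an open \<open>U\<close> around \<open>A\<close>, inner
  regularity a compact \<open>K\<close> inside \<open>U\<close>, and Urysohn's lemma a
  \<open>u\<close> that is 1 on \<open>K\<close> and 0 off \<open>U\<close>. The upper bound is
  pointwise, with \<open>D = U - A\<close> carrying the excess, since it is later translated and
  multiplied by \<open>h\<close>; the lower bound is used only in integrated form.\<close>

lemma continuous_approx_indicator:
  assumes A: "A \<in> sets M" and eps: "0 < (\<epsilon>::real)"
  obtains u :: "'g \<Rightarrow> real" and D where "continuous_on UNIV u" "D \<in> sets M" "emeasure M D \<le> ennreal \<epsilon>"
    "\<And>y. ennreal (u y) \<le> indicator A y + indicator D y"
    "emeasure M A \<le> (\<integral>\<^sup>+y. ennreal (u y) \<partial>M) + ennreal \<epsilon>"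
proof -
  note [measurable] = A
  have A': "A \<in> sets borel" using A by (simp add: sets_M)
  have "emeasure M A = (INF U \<in> {U. open U \<and> A \<subseteq> U}. emeasure M U)"
    using haar A' unfolding haar_prob_def by blast
  from INF_approx_ennreal[OF eps this emeasure_finite[folded infinity_ennreal_def]] obtain U where U: "open U" "A \<subseteq> U"
    "emeasure M U < emeasure M A + ennreal \<epsilon>" by auto
  have U_M [measurable]: "U \<in> sets M" using U(1) by (simp add: sets_M)
  have "emeasure M U = (SUP K \<in> {K. compact K \<and> K \<subseteq> U}. emeasure M K)"
    using haar U(1) unfolding haar_prob_def by blast
  from SUP_approx_ennreal[OF eps _ this emeasure_finite[folded infinity_ennreal_def]] obtain K where K: "compact K" "K \<subseteq> U"
    "emeasure M U < emeasure M K + ennreal \<epsilon>" by auto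
  have K_M [measurable]: "K \<in> sets M" using compact_imp_closed[OF K(1)] by (simp add: sets_M)
  have "Hausdorff_space (euclidean :: 'g topology)"
    unfolding Hausdorff_space_def disjnt_def using hausdorff by simp blast
  then have "normal_space (euclidean :: 'g topology)"
    by (intro compact_Hausdorff_or_regular_imp_normal_space)
      (simp_all add: compact_space_def compact_group)
  moreover have "closedin euclidean (- U)" "closedin euclidean K" "disjnt (- U) K"
    using U(1) K(2) compact_imp_closed[OF K(1)] by (auto simp: disjnt_def)
  ultimately obtain u where u: "continuous_map euclidean (top_of_set {0..1::real}) u"
    "u ` (- U) \<subseteq> {0}" "u ` K \<subseteq> {1}"
    unfolding normal_space_iff_Urysohn by meson
  have uc: "continuous_on UNIV u" and u01: "\<And>y. 0 \<le> u y \<and> u y \<le> 1"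
    using u(1) by (auto simp: continuous_map_in_subtopology image_subset_iff Pi_iff)
  have [measurable]: "u \<in> borel_measurable M" by (rule continuous_imp_measurable_M[OF uc])
  show ?thesis
  proof (rule that[OF uc, of "U - A"])
    show "U - A \<in> sets M" by simp
    have "emeasure M (U - A) = emeasure M U - emeasure M A"
      by (rule emeasure_Diff) (auto simp: U(2))
    also have "\<dots> \<le> ennreal \<epsilon>"
      using U(3) by (subst ennreal_minus_le_iff) (auto simp: less_imp_le)
    finally show "emeasure M (U - A) \<le> ennreal \<epsilon>" .
    show "ennreal (u y) \<le> indicator A y + indicator (U - A) y" for y
      using u01[of y] u(2) U(2) by (cases "y \<in> U") (auto simp: indicator_def)
    have "emeasure M K = (\<integral>\<^sup>+y. indicator K y \<partial>M)" by simp
    also have "\<dots> \<le> (\<integral>\<^sup>+y. ennreal (u y) \<partial>M)"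
      using u(3) by (intro nn_integral_mono) (auto simp: indicator_def)
    finally have "emeasure M K \<le> (\<integral>\<^sup>+y. ennreal (u y) \<partial>M)" .
    moreover have "emeasure M A \<le> emeasure M U" by (rule emeasure_mono[OF U(2) U_M])
    ultimately show "emeasure M A \<le> (\<integral>\<^sup>+y. ennreal (u y) \<partial>M) + ennreal \<epsilon>"
      using K(3) by (meson add_right_mono less_imp_le order_trans)
  qed
qed

text \<open>Stated as an inequality with \<open>x\<close> outside any integral: measurability in \<open>x\<close> of the convolution
  integral is unclear for Borel sets \<open>A\<close>.\<close>

lemma emeasure_mult_nn_integral_le_bounded:
  assumes A [measurable]: "A \<in> sets M" and h [measurable]: "h \<in> borel_measurable M"
    and N: "\<And>y. h y \<le> of_nat N"
    and le: "\<And>x. (\<integral>\<^sup>+y. indicator A (- x + y) * h y \<partial>M) \<le> c"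
  shows "emeasure M A * (\<integral>\<^sup>+y. h y \<partial>M) \<le> c"
proof (rule ennreal_le_epsilon)
  fix \<delta> :: real assume "0 < \<delta>"
  \<comment> \<open>One error \<open>N * \<epsilon>\<close> comes from the excess of
    \<open>u\<close> over the indicator, another from the loss in the integral of \<open>u\<close>;
    the \<open>+ 1\<close> covers \<open>N = 0\<close>.\<close>
  define \<epsilon> where "\<epsilon> = \<delta> / (2 * real N + 1)"
  have eps: "0 < \<epsilon>" "2 * real N * \<epsilon> \<le> \<delta>"
    using \<open>0 < \<delta>\<close> by (auto simp: \<epsilon>_def field_simps)
  from continuous_approx_indicator[OF A eps(1)] obtain u D
    where u: "continuous_on UNIV (u :: 'g \<Rightarrow> real)" and D [measurable]: "D \<in> sets M"
      and D': "emeasure M D \<le> ennreal \<epsilon>" and ule: "\<And>y. ennreal (u y) \<le> indicator A y + indicator D y"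
      and Ale: "emeasure M A \<le> (\<integral>\<^sup>+y. ennreal (u y) \<partial>M) + ennreal \<epsilon>" by blast
  let ?E = "of_nat N * ennreal \<epsilon>"
  have "(\<integral>\<^sup>+y. ennreal (u (- x + y)) * h y \<partial>M) \<le> c + ?E" for x
  proof -
    have "(\<integral>\<^sup>+y. ennreal (u (- x + y)) * h y \<partial>M)
        \<le> (\<integral>\<^sup>+y. indicator A (- x + y) * h y + of_nat N * indicator D (- x + y) \<partial>M)"
    proof (rule nn_integral_mono)
      fix y
      have "ennreal (u (- x + y)) * h y \<le> (indicator A (- x + y) + indicator D (- x + y)) * h y"
        by (intro mult_right_mono ule) simp
      also have "\<dots> \<le> indicator A (- x + y) * h y + of_nat N * indicator D (- x + y)"
        using N[of y] by (auto simp: distrib_right indicator_def intro: add_left_mono)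
      finally show "ennreal (u (- x + y)) * h y
        \<le> indicator A (- x + y) * h y + of_nat N * indicator D (- x + y)" .
    qed
    also have "\<dots> = (\<integral>\<^sup>+y. indicator A (- x + y) * h y \<partial>M) + (\<integral>\<^sup>+y. of_nat N * indicator D (- x + y) \<partial>M)"
      by (rule nn_integral_add) simp_all
    also have "(\<integral>\<^sup>+y. of_nat N * indicator D (- x + y) \<partial>M) = of_nat N * emeasure M D"
      using nn_integral_plus_left[of "\<lambda>y. of_nat N * indicator D y" "- x"] by (simp add: nn_integral_cmult_indicator)
    also have "(\<integral>\<^sup>+y. indicator A (- x + y) * h y \<partial>M) + of_nat N * emeasure M D \<le> c + ?E"
      by (intro add_mono le mult_left_mono D') simp
    finally show ?thesis .
  qed
  \<comment> \<open>Averaging over \<open>x\<close> with total mass 1 preserves the constant bound,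
    while the left side becomes a product of integrals.\<close>
  then have "(\<integral>\<^sup>+x. (\<integral>\<^sup>+y. ennreal (u (- x + y)) * h y \<partial>M) \<partial>M) \<le> (\<integral>\<^sup>+x. c + ?E \<partial>M)"
    by (intro nn_integral_mono)
  then have 1: "(\<integral>\<^sup>+y. ennreal (u y) \<partial>M) * (\<integral>\<^sup>+y. h y \<partial>M) \<le> c + ?E"
    by (simp add: nn_integral_convolution_continuous[OF u h])
  have "(\<integral>\<^sup>+y. h y \<partial>M) \<le> (\<integral>\<^sup>+y. of_nat N \<partial>M)" by (intro nn_integral_mono N)
  then have 2: "(\<integral>\<^sup>+y. h y \<partial>M) \<le> of_nat N" by simp
  have "emeasure M A * (\<integral>\<^sup>+y. h y \<partial>M) \<le> ((\<integral>\<^sup>+y. ennreal (u y) \<partial>M) + ennreal \<epsilon>) * (\<integral>\<^sup>+y. h y \<partial>M)"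
    by (intro mult_right_mono Ale) simp
  also have "\<dots> \<le> (c + ?E) + ennreal \<epsilon> * of_nat N"
    unfolding distrib_right by (intro add_mono 1 mult_left_mono 2) simp
  also have "\<dots> = c + ennreal (2 * real N * \<epsilon>)"
  proof -
    have "?E = ennreal (real N * \<epsilon>)" using eps(1) by (simp add: ennreal_mult ennreal_of_nat_eq_real_of_nat)
    moreover have "ennreal (2 * real N * \<epsilon>) = ennreal (real N * \<epsilon>) + ennreal (real N * \<epsilon>)"
      using eps(1) by (subst ennreal_plus[symmetric]) auto
    ultimately show ?thesis by (simp add: mult.commute[of "ennreal \<epsilon>"] add.assoc)
  qed
  also have "\<dots> \<le> c + ennreal \<delta>" by (intro add_left_mono ennreal_leI eps)
  finally show "emeasure M A * (\<integral>\<^sup>+y. h y \<partial>M) \<le> c + ennreal \<delta>" .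
qed

text \<open>The exceptional set \<open>D\<close> is small only in measure, so its contribution was
  controlled for bounded \<open>h\<close>. Since \<open>c\<close> does not depend on the bound,
  truncation and monotone convergence give the general case.\<close>

lemma emeasure_mult_nn_integral_le:
  assumes A [measurable]: "A \<in> sets M" and h [measurable]: "h \<in> borel_measurable M"
    and le: "\<And>x. (\<integral>\<^sup>+y. indicator A (- x + y) * h y \<partial>M) \<le> c"
  shows "emeasure M A * (\<integral>\<^sup>+y. h y \<partial>M) \<le> c"
proof -
  have SUP: "(SUP N. inf (h y) (of_nat N)) = h y" for y
    by (simp add: inf_SUP[symmetric] ennreal_SUP_of_nat_eq_top)
  have "(\<integral>\<^sup>+y. h y \<partial>M) = (\<integral>\<^sup>+y. (SUP N. inf (h y) (of_nat N)) \<partial>M)"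
    by (simp only: SUP)
  also have "\<dots> = (SUP N. \<integral>\<^sup>+y. inf (h y) (of_nat N) \<partial>M)"
  proof (rule nn_integral_monotone_convergence_SUP)
    show "incseq (\<lambda>N y. inf (h y) (of_nat N))"
      unfolding incseq_def le_fun_def by (intro allI impI inf_mono order_refl of_nat_mono)
  qed simp
  finally have "(\<integral>\<^sup>+y. h y \<partial>M) = (SUP N. \<integral>\<^sup>+y. inf (h y) (of_nat N) \<partial>M)" .
  then have "emeasure M A * (\<integral>\<^sup>+y. h y \<partial>M) = (SUP N. emeasure M A * (\<integral>\<^sup>+y. inf (h y) (of_nat N) \<partial>M))"
    by (simp add: SUP_mult_left_ennreal)
  also have "\<dots> \<le> c"
  proof (rule SUP_least)
    fix N
    have "(\<integral>\<^sup>+y. indicator A (- x + y) * inf (h y) (of_nat N) \<partial>M) \<le> c" for x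
      by (rule order_trans[OF nn_integral_mono le[of x]]) (simp add: mult_left_mono)
    then show "emeasure M A * (\<integral>\<^sup>+y. inf (h y) (of_nat N) \<partial>M) \<le> c"
      by (intro emeasure_mult_nn_integral_le_bounded[OF A, where N = N]) auto
  qed
  finally show ?thesis .
qed

end

subsection \<open>Operators commuting with translations\<close>

context compact_haar_group
begin

lemma orthonormal_plus_left:
  "orthonormal_family M I f \<Longrightarrow> orthonormal_family M I (\<lambda>i y. f i (a + y))"
  unfolding orthonormal_family_def by (auto simp: L2_plus_left l2inner_plus_left)

text \<open>This is the squared Hilbert--Schmidt norm of \<open>R\<close> followed by multiplication by \<open>sqrt \<psi>\<close>; as a
  function of \<open>\<psi>\<close> it is integration against a left-invariant measure.\<close>

definition weighted_hs :: "(('g \<Rightarrow> complex) \<Rightarrow> ('g \<Rightarrow> complex)) \<Rightarrow> ('g \<Rightarrow> complex) set \<Rightarrow> ('g \<Rightarrow> ennreal) \<Rightarrow> ennreal" where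
  "weighted_hs R B \<psi> = (\<integral>\<^sup>+e. (\<integral>\<^sup>+y. \<psi> y * ennreal ((cmod (R e y))\<^sup>2) \<partial>M) \<partial>count_space B)"

context
  fixes R :: "('g \<Rightarrow> complex) \<Rightarrow> ('g \<Rightarrow> complex)" and B :: "('g \<Rightarrow> complex) set"
  assumes R: "bounded_op M R"
    and commutes: "\<And>a f. f \<in> L2 M \<Longrightarrow> AE y in M. R (\<lambda>z. f (- a + z)) y = R f (- a + y)"
    and B: "onb M B"
begin

lemma R_measurable: "e \<in> B \<Longrightarrow> R e \<in> borel_measurable M"
  by (intro L2_measurable bounded_op_L2[OF R] onb_L2[OF B])

text \<open>Moving \<open>A\<close> by \<open>x\<close> amounts to moving the basis vectors by the
  inverse of \<open>x\<close>, because \<open>R\<close> commutes with translations; the moved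
  vectors stay orthonormal, so the bound is uniform in \<open>x\<close> and can be averaged.
  Finiteness of \<open>F\<close> makes the sum of the squared moduli a measurable function to which
  averaging applies.\<close>

lemma weighted_hs_indicator_ge:
  assumes A [measurable]: "A \<in> sets M"
  shows "emeasure M A * weighted_hs R B (\<lambda>_. 1) \<le> weighted_hs R B (indicator A)"
proof -
  let ?T = "\<lambda>f x. indicator A x * R f x"
  let ?q = "\<lambda>e y. ennreal ((cmod (R e y))\<^sup>2)"
  have T: "bounded_op M ?T" by (rule bounded_op_indicator_comp[OF A R])
  have T_sq: "ennreal ((l2norm M (?T f))\<^sup>2) = (\<integral>\<^sup>+y. indicator A y * ?q f y \<partial>M)" if "f \<in> L2 M" for f
    unfolding ennreal_l2norm_sq[OF bounded_op_L2[OF T that]]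
    by (intro nn_integral_cong) (auto simp: indicator_def)
  have translate: "(\<Sum>e\<in>F. \<integral>\<^sup>+y. indicator A (- x + y) * ?q e y \<partial>M) \<le> weighted_hs R B (indicator A)"
    if F: "finite F" "F \<subseteq> B" for F x
  proof -
    have "(\<integral>\<^sup>+y. indicator A (- x + y) * ?q e y \<partial>M)
        = ennreal ((l2norm M (?T (\<lambda>y. e (x + y))))\<^sup>2)" if "e \<in> F" for e
    proof -
      have e: "e \<in> B" using that F by blast
      note eL = onb_L2[OF B e]
      note [measurable] = R_measurable[OF e]
      have "(\<integral>\<^sup>+y. indicator A (- x + y) * ?q e y \<partial>M)
          = (\<integral>\<^sup>+y. indicator A (- x + (x + y)) * ?q e (x + y) \<partial>M)"
        by (rule nn_integral_plus_left[symmetric]) simp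
      also have "\<dots> = (\<integral>\<^sup>+y. indicator A y * ?q (\<lambda>z. e (x + z)) y \<partial>M)"
        by (rule nn_integral_cong_AE)
          (use commutes[OF eL, of "- x"] in eventually_elim, simp add: add.assoc[symmetric])
      also have "\<dots> = ennreal ((l2norm M (?T (\<lambda>y. e (x + y))))\<^sup>2)"
        by (rule T_sq[OF L2_plus_left[OF eL], symmetric])
      finally show ?thesis .
    qed
    then have "(\<Sum>e\<in>F. \<integral>\<^sup>+y. indicator A (- x + y) * ?q e y \<partial>M)
        = (\<Sum>e\<in>F. ennreal ((l2norm M (?T (\<lambda>y. e (x + y))))\<^sup>2))"
      by (rule sum.cong[OF refl])
    also have "\<dots> \<le> (\<integral>\<^sup>+e. ennreal ((l2norm M (?T e))\<^sup>2) \<partial>count_space B)"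
      by (rule orthonormal_hs_le_onb[OF T B F(1)
            orthonormal_plus_left[OF orthonormal_family_subset[OF onb_orthonormal[OF B] F(2)]]])
    also have "\<dots> = weighted_hs R B (indicator A)"
      unfolding weighted_hs_def using onb_L2[OF B] by (intro nn_integral_cong) (simp add: T_sq)
    finally show ?thesis .
  qed
  have "emeasure M A * weighted_hs R B (\<lambda>_. 1)
      = (\<integral>\<^sup>+e. emeasure M A * (\<integral>\<^sup>+y. ?q e y \<partial>M) \<partial>count_space B)"
    unfolding weighted_hs_def by (simp add: nn_integral_cmult)
  also have "\<dots> \<le> weighted_hs R B (indicator A)"
  proof (rule nn_integral_count_space_le)
    fix F assume F: "finite F" "F \<subseteq> B"
    have [measurable]: "R e \<in> borel_measurable M" if "e \<in> F" for e
      using that F R_measurable by blast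
    have "(\<Sum>e\<in>F. emeasure M A * (\<integral>\<^sup>+y. ?q e y \<partial>M)) = emeasure M A * (\<integral>\<^sup>+y. (\<Sum>e\<in>F. ?q e y) \<partial>M)"
      by (subst nn_integral_sum) (simp_all add: sum_distrib_left)
    also have "\<dots> \<le> weighted_hs R B (indicator A)"
    proof (rule emeasure_mult_nn_integral_le[OF A])
      fix x
      have "(\<integral>\<^sup>+y. indicator A (- x + y) * (\<Sum>e\<in>F. ?q e y) \<partial>M)
          = (\<Sum>e\<in>F. \<integral>\<^sup>+y. indicator A (- x + y) * ?q e y \<partial>M)"
        by (subst nn_integral_sum[symmetric]) (simp_all add: sum_distrib_left del: sum_ennreal)
      then show "(\<integral>\<^sup>+y. indicator A (- x + y) * (\<Sum>e\<in>F. ?q e y) \<partial>M) \<le> weighted_hs R B (indicator A)"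
        using translate[OF F] by simp
    qed simp
    finally show "(\<Sum>e\<in>F. emeasure M A * (\<integral>\<^sup>+y. ?q e y \<partial>M)) \<le> weighted_hs R B (indicator A)" .
  qed
  finally show ?thesis .
qed

lemma weighted_hs_add:
  assumes [measurable]: "\<phi> \<in> borel_measurable M" "\<psi> \<in> borel_measurable M"
  shows "weighted_hs R B (\<lambda>y. \<phi> y + \<psi> y) = weighted_hs R B \<phi> + weighted_hs R B \<psi>"
proof -
  have "weighted_hs R B (\<lambda>y. \<phi> y + \<psi> y) = (\<integral>\<^sup>+e. (\<integral>\<^sup>+y. \<phi> y * ennreal ((cmod (R e y))\<^sup>2) \<partial>M)
      + (\<integral>\<^sup>+y. \<psi> y * ennreal ((cmod (R e y))\<^sup>2) \<partial>M) \<partial>count_space B)"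
    unfolding weighted_hs_def
  proof (rule nn_integral_cong)
    fix e assume "e \<in> space (count_space B)"
    then have [measurable]: "R e \<in> borel_measurable M" by (simp add: R_measurable)
    show "(\<integral>\<^sup>+y. (\<phi> y + \<psi> y) * ennreal ((cmod (R e y))\<^sup>2) \<partial>M)
      = (\<integral>\<^sup>+y. \<phi> y * ennreal ((cmod (R e y))\<^sup>2) \<partial>M) + (\<integral>\<^sup>+y. \<psi> y * ennreal ((cmod (R e y))\<^sup>2) \<partial>M)"
      by (subst nn_integral_add[symmetric]) (simp_all add: distrib_right)
  qed
  then show ?thesis by (simp add: weighted_hs_def nn_integral_add)
qed

text \<open>The previous inequality for \<open>A\<close> and for its complement adds up to an equality.\<close>

lemma weighted_hs_indicator:
  assumes A [measurable]: "A \<in> sets M"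
  shows "weighted_hs R B (indicator A) = weighted_hs R B (\<lambda>_. 1) * emeasure M A"
proof -
  let ?n = "weighted_hs R B (\<lambda>_. 1)"
  have A' [measurable]: "- A \<in> sets M" using sets.compl_sets[OF A] by (simp add: Compl_eq_Diff_UNIV)
  have "(\<lambda>y. indicator A y + indicator (- A) y) = (\<lambda>_::'g. 1 :: ennreal)"
    by (auto simp: indicator_def)
  then have sum: "weighted_hs R B (indicator A) + weighted_hs R B (indicator (- A)) = ?n"
    using weighted_hs_add[of "indicator A" "indicator (- A)"] by simp
  have one: "emeasure M A + emeasure M (- A) = 1"
    using plus_emeasure[OF A A'] by (simp add: Compl_partition)
  note ge = weighted_hs_indicator_ge[OF A] weighted_hs_indicator_ge[OF A']
  show ?thesis
  \<comment> \<open>For infinite \<open>?n\<close> the lower bound settles sets of positive mass but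
    says nothing about null sets; on these every integral vanishes, in accordance with
    \<open>top * 0 = 0\<close>. The complement is used only for finite \<open>?n\<close>, where
    subtraction is legitimate.\<close>
  proof (cases "emeasure M A = 0")
    case True
    then have ae: "AE y in M. y \<notin> A" using A by (intro AE_not_in) (auto simp: null_sets_def)
    have "(\<integral>\<^sup>+y. indicator A y * ennreal ((cmod (R e y))\<^sup>2) \<partial>M) = (\<integral>\<^sup>+y. 0 \<partial>M)" for e
      by (rule nn_integral_cong_AE) (use ae in eventually_elim, simp)
    then show ?thesis by (simp add: weighted_hs_def True)
  next
    case False
    show ?thesis
    proof (cases "?n = top")
      case True
      then show ?thesis using ge(1) False by (simp add: ennreal_mult_top ennreal_top_mult top_unique)
    next
      case fin: False
      have fin': "emeasure M (- A) * ?n \<noteq> top"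
        using fin emeasure_finite by (simp add: ennreal_mult_eq_top_iff)
      have "emeasure M (- A) * ?n + weighted_hs R B (indicator A)
          \<le> weighted_hs R B (indicator (- A)) + weighted_hs R B (indicator A)"
        by (intro add_right_mono ge)
      also have "\<dots> = (emeasure M A + emeasure M (- A)) * ?n"
        using sum one by (simp add: add.commute)
      also have "\<dots> = emeasure M (- A) * ?n + emeasure M A * ?n"
        by (simp add: distrib_right add.commute)
      finally have "weighted_hs R B (indicator A) \<le> emeasure M A * ?n"
        using fin' by (simp add: ennreal_add_left_cancel_le)
      then show ?thesis using ge(1) by (simp add: mult.commute)
    qed
  qed
qed

text \<open>Both sides are additive, homogeneous and continuous along increasing sequences in
  \<psi>, so agreement on indicators suffices. On the left, monotone convergence is applied first
  over the group and then over \<open>B\<close>; as it concerns sequences, an uncountable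
  \<open>B\<close> does no harm.\<close>

lemma weighted_hs_eq:
  assumes "\<psi> \<in> borel_measurable M"
  shows "weighted_hs R B \<psi> = weighted_hs R B (\<lambda>_. 1) * (\<integral>\<^sup>+y. \<psi> y \<partial>M)"
  using assms
proof (induction rule: borel_measurable_induct)
  case (cong f g)
  then have "f = g" by auto
  then show ?case using cong by simp
next
  case (set A)
  then show ?case by (simp add: weighted_hs_indicator)
next
  case (mult u c)
  note [measurable] = mult(2)
  have "weighted_hs R B (\<lambda>y. c * u y) = (\<integral>\<^sup>+e. c * (\<integral>\<^sup>+y. u y * ennreal ((cmod (R e y))\<^sup>2) \<partial>M) \<partial>count_space B)"
    unfolding weighted_hs_def
  proof (rule nn_integral_cong)
    fix e assume "e \<in> space (count_space B)"
    then have [measurable]: "R e \<in> borel_measurable M" by (simp add: R_measurable)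
    show "(\<integral>\<^sup>+y. c * u y * ennreal ((cmod (R e y))\<^sup>2) \<partial>M) = c * (\<integral>\<^sup>+y. u y * ennreal ((cmod (R e y))\<^sup>2) \<partial>M)"
      by (subst nn_integral_cmult[symmetric]) (simp_all add: mult.assoc)
  qed
  also have "\<dots> = c * weighted_hs R B u" by (simp add: weighted_hs_def nn_integral_cmult)
  finally show ?case using mult by (simp add: nn_integral_cmult mult.left_commute)
next
  case (add u v)
  then show ?case by (simp add: weighted_hs_add nn_integral_add distrib_left)
next
  case (seq U)
  note [measurable] = seq(1)
  have mono: "incseq (\<lambda>i y. U i y * ennreal ((cmod (R e y))\<^sup>2))" for e
    using seq(3) by (auto simp: incseq_def le_fun_def intro!: mult_right_mono)
  have u: "(SUP i. U i) = (\<lambda>y. SUP i. U i y)" by (rule ext, rule SUP_apply)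
  have "weighted_hs R B (SUP i. U i)
      = (\<integral>\<^sup>+e. (SUP i. \<integral>\<^sup>+y. U i y * ennreal ((cmod (R e y))\<^sup>2) \<partial>M) \<partial>count_space B)"
    unfolding weighted_hs_def u
  proof (rule nn_integral_cong)
    fix e assume "e \<in> space (count_space B)"
    then have [measurable]: "R e \<in> borel_measurable M" by (simp add: R_measurable)
    show "(\<integral>\<^sup>+y. (SUP i. U i y) * ennreal ((cmod (R e y))\<^sup>2) \<partial>M)
      = (SUP i. \<integral>\<^sup>+y. U i y * ennreal ((cmod (R e y))\<^sup>2) \<partial>M)"
      by (subst nn_integral_monotone_convergence_SUP[symmetric, OF mono])
        (simp_all add: SUP_mult_right_ennreal)
  qed
  also have "\<dots> = (SUP i. weighted_hs R B (U i))"
    unfolding weighted_hs_def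
  proof (rule nn_integral_monotone_convergence_SUP)
    show "incseq (\<lambda>i e. \<integral>\<^sup>+y. U i y * ennreal ((cmod (R e y))\<^sup>2) \<partial>M)"
      using mono by (auto simp: incseq_def le_fun_def intro!: nn_integral_mono)
  qed simp
  also have "\<dots> = (SUP i. weighted_hs R B (\<lambda>_. 1) * (\<integral>\<^sup>+y. U i y \<partial>M))"
    using seq by simp
  also have "\<dots> = weighted_hs R B (\<lambda>_. 1) * (SUP i. \<integral>\<^sup>+y. U i y \<partial>M)"
    by (rule SUP_mult_left_ennreal[symmetric])
  also have "(SUP i. \<integral>\<^sup>+y. U i y \<partial>M) = (\<integral>\<^sup>+y. (SUP i. U i) y \<partial>M)"
    unfolding u by (rule nn_integral_monotone_convergence_SUP[symmetric, OF seq(3)]) simp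
  finally show ?case .
qed

end

end

theorem theorem1:
  fixes M :: "'g::{group_add, t2_space} measure"
    and P R :: "('g \<Rightarrow> complex) \<Rightarrow> ('g \<Rightarrow> complex)"
  assumes "continuous_on UNIV (\<lambda>p::'g \<times> 'g. fst p + snd p)"
    and "continuous_on UNIV (uminus :: 'g \<Rightarrow> 'g)"
    and "compact (UNIV :: 'g set)"
    and "haar_prob M"
    and "bounded_op M P" and "bounded_op M R"
    and "\<forall>S \<in> sets M. \<forall>f \<in> L2 M.
           AE x in M. P (\<lambda>y. indicator S y * f y) x = indicator S x * P f x"
    and "\<forall>a. \<forall>f \<in> L2 M. AE y in M. R (\<lambda>z. f (- a + z)) y = R f (- a + y)"
  shows "hs_norm M (P \<circ> R) = ennreal (l2norm M (P (\<lambda>_. 1))) * hs_norm M R \<and>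
         ennreal (op_norm M (P \<circ> R)) \<le> ennreal (l2norm M (P (\<lambda>_. 1))) * hs_norm M R"
proof -
  interpret compact_haar_group M by unfold_locales fact+
  note P = assms(5) and R = assms(6)
  have comm: "AE y in M. R (\<lambda>z. f (- a + z)) y = R f (- a + y)" if "f \<in> L2 M" for a f
    using assms(8) that by blast
  obtain B where B: "onb M B"
    and hs: "\<And>T. hs_norm_sq M T = (\<integral>\<^sup>+e. ennreal ((l2norm M (T e))\<^sup>2) \<partial>count_space B)"
    using hs_norm_sq_onb[of M] by blast
  define \<phi> where "\<phi> = P (\<lambda>_. 1)"
  have \<phi>: "\<phi> \<in> L2 M" unfolding \<phi>_def by (rule bounded_op_L2[OF P]) (simp add: L2_def)
  note [measurable] = L2_measurable[OF \<phi>]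
  have mult: "AE x in M. P f x = f x * \<phi> x" if "f \<in> L2 M" for f
    unfolding \<phi>_def using assms(7)
    by (intro commutes_indicators_imp_multiplication[OF finite_measure_axioms P _ that]) blast
  \<comment> \<open>Since \<open>P\<close> multiplies by \<phi>, each basis vector contributes the
    integral of the squared modulus of \<open>R e\<close> with weight the squared modulus of
    \<phi>.\<close>
  have "hs_norm_sq M (P \<circ> R) = weighted_hs R B (\<lambda>y. ennreal ((cmod (\<phi> y))\<^sup>2))"
    unfolding hs weighted_hs_def
  proof (rule nn_integral_cong)
    fix e assume "e \<in> space (count_space B)"
    then have "e \<in> L2 M" using onb_L2[OF B] by simp
    then have Re: "R e \<in> L2 M" by (rule bounded_op_L2[OF R])
    have "ennreal ((l2norm M ((P \<circ> R) e))\<^sup>2) = (\<integral>\<^sup>+y. ennreal ((cmod (P (R e) y))\<^sup>2) \<partial>M)"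
      by (simp add: ennreal_l2norm_sq bounded_op_L2[OF P Re])
    also have "\<dots> = (\<integral>\<^sup>+y. ennreal ((cmod (\<phi> y))\<^sup>2) * ennreal ((cmod (R e y))\<^sup>2) \<partial>M)"
      by (rule nn_integral_cong_AE)
        (use mult[OF Re] in eventually_elim, simp add: norm_mult power_mult_distrib ennreal_mult mult.commute)
    finally show "ennreal ((l2norm M ((P \<circ> R) e))\<^sup>2)
      = (\<integral>\<^sup>+y. ennreal ((cmod (\<phi> y))\<^sup>2) * ennreal ((cmod (R e y))\<^sup>2) \<partial>M)" .
  qed
  also have "\<dots> = weighted_hs R B (\<lambda>_. 1) * ennreal ((l2norm M \<phi>)\<^sup>2)"
    by (subst weighted_hs_eq[OF R comm B]) (simp_all add: ennreal_l2norm_sq[OF \<phi>])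
  also have "weighted_hs R B (\<lambda>_. 1) = hs_norm_sq M R"
    unfolding hs weighted_hs_def
    by (intro nn_integral_cong) (simp add: ennreal_l2norm_sq bounded_op_L2[OF R] onb_L2[OF B])
  finally have sq: "hs_norm_sq M (P \<circ> R) = hs_norm_sq M R * ennreal ((l2norm M \<phi>)\<^sup>2)" .
  have eq: "hs_norm M (P \<circ> R) = ennreal (l2norm M \<phi>) * hs_norm M R"
  proof (cases "hs_norm_sq M R = \<infinity>")
    case True
    \<comment> \<open>If \<phi> has norm zero, the convention \<open>0 * \<infinity> = 0\<close> in
      \<open>ennreal\<close> makes both sides zero; otherwise both are infinite.\<close>
    then show ?thesis using sq by (cases "l2norm M \<phi> = 0") (simp_all add: hs_norm_def ennreal_mult_top ennreal_top_mult)
  next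
    case False
    then have "hs_norm_sq M R = ennreal (enn2real (hs_norm_sq M R))" by (simp add: less_top)
    then obtain r where r: "0 \<le> r" "hs_norm_sq M R = ennreal r" using enn2real_nonneg by blast
    then have "hs_norm_sq M (P \<circ> R) = ennreal (r * (l2norm M \<phi>)\<^sup>2)"
      using sq by (simp add: ennreal_mult)
    then have "hs_norm M (P \<circ> R) = ennreal (sqrt (r * (l2norm M \<phi>)\<^sup>2))"
      using r(1) unfolding hs_norm_def by (simp del: ennreal_mult'')
    also have "\<dots> = ennreal (l2norm M \<phi>) * ennreal (sqrt r)"
      using r(1) by (simp add: real_sqrt_mult ennreal_mult mult.commute)
    also have "ennreal (sqrt r) = hs_norm M R" using r by (simp add: hs_norm_def)
    finally show ?thesis .
  qed
  show ?thesis
    using eq op_norm_le_hs_norm[OF bounded_op_comp[OF P R]] unfolding \<phi>_def by simp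
qed

end
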